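(* Let $\lambda\in\Lambda_+$ and let $\mathcal{B}_\lambda$ be a discrete analytic Schur function such that $f\mapsto\mathcal{B}_\lambda\odot f$ is an isometry on $\mathbf{H}_2(\Lambda_+)$ with range $$\{f\in\mathbf{H}_2(\Lambda_+): f(z)=0\text{ for all }z\in R_\lambda\}.$$ Then, up to a unimodular multiplicative constant, $$\mathcal{B}_\lambda=z^{(\operatorname{Re}(\lambda)+1)}\odot\mathcal{B}_\pm^{\odot|\operatorname{Im}(\lambda)|},$$ where the sign "$\pm$" stands for "$+$" if $\operatorname{Im}(\lambda)\ge 0$ and for "$-$" otherwise.
   Context: Let $\Lambda=\mathbb{Z}+i\mathbb{Z}\subset\mathbb{C}$ and $\Lambda_+=\{z\in\Lambda:\operatorname{Re}(z)\ge 0\}$. A function $f$ on $\Lambda$ (respectively $\Lambda_+$) is discrete analytic if $$\frac{f(z+1+i)-f(z)}{1+i}=\frac{f(z+1)-f(z+i)}{1-i}$$ for all $z\in\Lambda$ (respectively $z\in\Lambda_+$). A path from $a$ to $b$ is a finite sequence $\gamma=(z_0,\ldots,z_n)$ of lattice points with $z_0=a$, $z_n=b$, $|z_k-z_{k-1}|=1$, and $\int_\gamma f\,\delta z=\sum_{k=1}^n\frac{f(z_{k-1})+f(z_k)}{2}(z_k-z_{k-1})$. For a discrete analytic $f$ this integral depends only on the endpoints (for $f$ defined on $\Lambda_+$, paths are taken in $\Lambda_+$). Define $$(Zf)(z)=\frac{f(0)-f(z)}{2}+\int_0^z f\,\delta z.$$ For $n\ge 0$, $z^{(n)}:=(Z^n1)(z)$,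 a discrete analytic polynomial of degree $n$; in particular $z^{(0)}=1$ and $z^{(1)}=z$. If $\limsup_n|\hat f(n)|^{1/n}<\sqrt2$, the series $\sum_n\hat f(n)z^{(n)}$ converges absolutely on $\Lambda_+$ to a discrete analytic function $f$ that determines the coefficients $\hat f(n)$ uniquely. The Hardy space $\mathbf{H}_2(\Lambda_+)$ is the Hilbert space of functions $f(z)=\sum_{n=0}^\infty\hat f(n)z^{(n)}$ on $\Lambda_+$ with $\sum_n|\hat f(n)|^2<\infty$, with inner product $\langle f,g\rangle=\sum_{n=0}^\infty\hat f(n)\overline{\hat g(n)}$. A function $s$ discrete analytic on $\Lambda_+$ is called a discrete analytic Schur function if $\sum_{n=0}^\infty|(Z^ns)(z)|^2<\infty$ for all $z\in\Lambda_+$ and the kernel $$K^s_w(z)=\sum_{n=0}^\infty\left(z^{(n)}\,\overline{w^{(n)}}-(Z^ns)(z)\,\overline{(Z^ns)(w)}\right)$$ is positive in $\Lambda_+$, i.e. $\sum_{j,k=1}^N c_j\overline{c_k}\,K^s_{w_k}(w_j)\ge 0$ for all $N\ge1$, $w_1,\ldots,w_N\in\Lambda_+$, $c_1,\ldots,c_N\in\mathbb{C}$. Every discrete analytic Schur function $s$ lies in $\mathbf{H}_2(\Lambda_+)$. The convolution product is $$(s\odot f)(z)=\sum_{n=0}^\infty\sum_{m=0}^n\hat s(m)\hat f(n-m)z^{(n)};$$ for $s$ a discrete analytic Schur function and $f\in\mathbf{H}_2(\Lambda_+)$ it converges absolutely on $\Lambda_+$ and $f\mapsto s\odot f$ is a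 contraction on $\mathbf{H}_2(\Lambda_+)$. $s^{\odot k}$ denotes the $k$-fold convolution power, with $s^{\odot 0}=1$. For $\lambda\in\Lambda_+$, $$R_\lambda=\{z\in\Lambda_+:\operatorname{Re}(z)\le\operatorname{Re}(\lambda),\ |\operatorname{Im}(z)|\le|\operatorname{Im}(\lambda)|,\ \operatorname{Im}(z)\operatorname{Im}(\lambda)\ge 0\}.$$ A discrete analytic Schur function $\mathcal{B}_\lambda$ with the property described in the claim exists for every $\lambda\in\Lambda_+$. Let $\alpha_\pm=\frac{1\pm i}{2}$. For $\alpha\in\mathbb{C}$ with $|\alpha|<1$ let $(1-\alpha z)^{-\odot}:=\sum_{n=0}^\infty\alpha^nz^{(n)}=(1+\alpha)^{\operatorname{Re}(z)}\left(\frac{1+\alpha_+\alpha}{1+\alpha_-\alpha}\right)^{\operatorname{Im}(z)}$, the inverse of $1-\alpha z$ with respect to $\odot$. The Blaschke factors are the discrete analytic Schur functions $$\mathcal{B}_\pm(z)=\alpha_\mp+\alpha_\pm z\odot(1+\alpha_\pm z)^{-\odot}\alpha_\mp$$ (upper signs for $\mathcal{B}_+$, lower signs for $\mathcal{B}_-$). *)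

theory Defs
  imports "HOL-Analysis.Analysis" "HOL-Library.FuncSet"
begin

text \<open>
  A function on the lattice half-plane \<open>\<Lambda>\<^sub>+\<close> is represented by an element of
  \<^term>\<open>extensional\<close> of that set, so that equality of functions on \<open>\<Lambda>\<^sub>+\<close> is equality in HOL.
\<close>

definition lattice_plus :: "complex set" ("\<Lambda>\<^sub>+") where
  "\<Lambda>\<^sub>+ = {z. Re z \<in> \<int> \<and> Im z \<in> \<int> \<and> Re z \<ge> 0}"

definition discrete_analytic :: "(complex \<Rightarrow> complex) \<Rightarrow> bool" where
  "discrete_analytic f \<longleftrightarrow> f \<in> extensional \<Lambda>\<^sub>+ \<and>
     (\<forall>z\<in>\<Lambda>\<^sub>+. (f (z + 1 + \<i>) - f z) / (1 + \<i>) = (f (z + 1) - f (z + \<i>)) / (1 - \<i>))"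

definition lattice_path :: "complex list \<Rightarrow> complex \<Rightarrow> complex \<Rightarrow> bool" where
  "lattice_path \<gamma> a b \<longleftrightarrow> \<gamma> \<noteq> [] \<and> set \<gamma> \<subseteq> \<Lambda>\<^sub>+ \<and> hd \<gamma> = a \<and> last \<gamma> = b \<and>
     (\<forall>k\<in>{1..<length \<gamma>}. cmod (\<gamma> ! k - \<gamma> ! (k - 1)) = 1)"

definition path_sum :: "complex list \<Rightarrow> (complex \<Rightarrow> complex) \<Rightarrow> complex" where
  "path_sum \<gamma> f =
     (\<Sum>k\<in>{1..<length \<gamma>}. (f (\<gamma> ! (k - 1)) + f (\<gamma> ! k)) / 2 * (\<gamma> ! k - \<gamma> ! (k - 1)))"

text \<open>The common value over all paths in \<open>\<Lambda>\<^sub>+\<close>; meaningful for discrete analytic \<open>f\<close>.\<close>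

definition discrete_integral :: "complex \<Rightarrow> complex \<Rightarrow> (complex \<Rightarrow> complex) \<Rightarrow> complex" where
  "discrete_integral a b f = (THE I. \<forall>\<gamma>. lattice_path \<gamma> a b \<longrightarrow> path_sum \<gamma> f = I)"

definition Zop :: "(complex \<Rightarrow> complex) \<Rightarrow> complex \<Rightarrow> complex" where
  "Zop f = (\<lambda>z\<in>\<Lambda>\<^sub>+. (f 0 - f z) / 2 + discrete_integral 0 z f)"

definition one_plus :: "complex \<Rightarrow> complex" where
  "one_plus = (\<lambda>z\<in>\<Lambda>\<^sub>+. 1)"

definition dpow :: "nat \<Rightarrow> complex \<Rightarrow> complex" where
  "dpow n = (Zop ^^ n) one_plus"

definition has_expansion :: "(complex \<Rightarrow> complex) \<Rightarrow> (nat \<Rightarrow> complex) \<Rightarrow> bool" where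
  "has_expansion f a \<longleftrightarrow> f \<in> extensional \<Lambda>\<^sub>+ \<and>
     limsup (\<lambda>n. ereal (root n (cmod (a n)))) < ereal (sqrt 2) \<and>
     (\<forall>z\<in>\<Lambda>\<^sub>+. (\<lambda>n. a n * dpow n z) sums f z)"

text \<open>
  The coefficient sequence of \<open>f\<close>. It is unique, since \<open>dpow n x\<close> is the binomial coefficient
  \<open>x choose n\<close> for \<open>x = 0, 1, 2, \<dots>\<close>.
\<close>

definition coeffs_of :: "(complex \<Rightarrow> complex) \<Rightarrow> nat \<Rightarrow> complex" where
  "coeffs_of f = (THE a. has_expansion f a)"

definition Hardy :: "(complex \<Rightarrow> complex) set" where
  "Hardy = {f. (\<exists>a. has_expansion f a) \<and> summable (\<lambda>n. (cmod (coeffs_of f n))\<^sup>2)}"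

definition Hardy_inner :: "(complex \<Rightarrow> complex) \<Rightarrow> (complex \<Rightarrow> complex) \<Rightarrow> complex" where
  "Hardy_inner f g = (\<Sum>n. coeffs_of f n * cnj (coeffs_of g n))"

definition Hardy_norm :: "(complex \<Rightarrow> complex) \<Rightarrow> real" where
  "Hardy_norm f = sqrt (Re (Hardy_inner f f))"

definition Schur_kernel :: "(complex \<Rightarrow> complex) \<Rightarrow> complex \<Rightarrow> complex \<Rightarrow> complex" where
  "Schur_kernel s w z =
     (\<Sum>n. dpow n z * cnj (dpow n w) - (Zop ^^ n) s z * cnj ((Zop ^^ n) s w))"

definition positive_kernel :: "(complex \<Rightarrow> complex \<Rightarrow> complex) \<Rightarrow> bool" where
  "positive_kernel K \<longleftrightarrow>
     (\<forall>N\<ge>1. \<forall>(w :: nat \<Rightarrow> complex) (c :: nat \<Rightarrow> complex). (\<forall>j\<in>{1..N}. w j \<in> \<Lambda>\<^sub>+) \<longrightarrow>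
        (\<Sum>j=1..N. \<Sum>k=1..N. c j * cnj (c k) * K (w k) (w j)) \<in> \<real>\<^sub>\<ge>\<^sub>0)"

definition Schur_function :: "(complex \<Rightarrow> complex) \<Rightarrow> bool" where
  "Schur_function s \<longleftrightarrow> discrete_analytic s \<and>
     (\<forall>z\<in>\<Lambda>\<^sub>+. summable (\<lambda>n. (cmod ((Zop ^^ n) s z))\<^sup>2)) \<and>
     positive_kernel (Schur_kernel s)"

definition dconv :: "(complex \<Rightarrow> complex) \<Rightarrow> (complex \<Rightarrow> complex) \<Rightarrow> complex \<Rightarrow> complex"
    (infixl "\<odot>" 70) where
  "s \<odot> f = (\<lambda>z\<in>\<Lambda>\<^sub>+. \<Sum>n. (\<Sum>m\<le>n. coeffs_of s m * coeffs_of f (n - m)) * dpow n z)"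

definition dconv_power :: "(complex \<Rightarrow> complex) \<Rightarrow> nat \<Rightarrow> complex \<Rightarrow> complex" where
  "dconv_power s k = ((\<lambda>f. s \<odot> f) ^^ k) one_plus"

definition isometry_on_Hardy ::
    "((complex \<Rightarrow> complex) \<Rightarrow> (complex \<Rightarrow> complex)) \<Rightarrow> bool" where
  "isometry_on_Hardy T \<longleftrightarrow> (\<forall>f\<in>Hardy. T f \<in> Hardy \<and> Hardy_norm (T f) = Hardy_norm f)"

definition rect :: "complex \<Rightarrow> complex set" where
  "rect l = {z\<in>\<Lambda>\<^sub>+. Re z \<le> Re l \<and> \<bar>Im z\<bar> \<le> \<bar>Im l\<bar> \<and> Im z * Im l \<ge> 0}"

definition alpha_plus :: complex where "alpha_plus = (1 + \<i>) / 2"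

definition alpha_minus :: complex where "alpha_minus = (1 - \<i>) / 2"

text \<open>The convolution inverse of \<open>1 - \<alpha> z\<close>.\<close>

definition geom_inv :: "complex \<Rightarrow> complex \<Rightarrow> complex" where
  "geom_inv \<alpha> = (\<lambda>z\<in>\<Lambda>\<^sub>+. \<Sum>n. \<alpha> ^ n * dpow n z)"

definition Blaschke_plus :: "complex \<Rightarrow> complex" where
  "Blaschke_plus = (\<lambda>z\<in>\<Lambda>\<^sub>+. alpha_minus +
     alpha_plus * ((\<lambda>u\<in>\<Lambda>\<^sub>+. u) \<odot> geom_inv (- alpha_plus)) z * alpha_minus)"

definition Blaschke_minus :: "complex \<Rightarrow> complex" where
  "Blaschke_minus = (\<lambda>z\<in>\<Lambda>\<^sub>+. alpha_plus +
     alpha_minus * ((\<lambda>u\<in>\<Lambda>\<^sub>+. u) \<odot> geom_inv (- alpha_minus)) z * alpha_plus)"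

end

theory Submission
  imports Defs
begin

text \<open>
For each lattice point \<open>z = x + i y\<close> the values \<open>z\<^sup>(\<^sup>n\<^sup>)\<close> are the Taylor coefficients of the rational
function \<open>G\<^sub>z = (1 + X)\<^sup>x ((1 + \<alpha>\<^sub>+ X) / (1 + \<alpha>\<^sub>- X))\<^sup>y\<close>. Thus \<open>f(z)\<close> is a bilinear pairing of the coefficient
series \<open>F\<close> of \<open>f\<close> with \<open>G\<^sub>z\<close>, the convolution product is multiplication of power series, the
Hardy norm is the \<open>l\<^sup>2\<close> norm of \<open>F\<close>, and every question becomes one about power series.

In these terms let \<open>\<beta> = (X + a) / (1 + a\<^sup>* X)\<close> be the series of the Blaschke factor, where
\<open>a = (1 - u) / 2\<close> and \<open>u = \<plusminus>i\<close> is the vertical direction of the rectangle. Two elementary identities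
replace the theory of inner functions. For \<open>F = (X + a) W\<close> and \<open>V = (1 + a\<^sup>* X) W\<close>, that is
\<open>F = \<beta> V\<close>, the difference \<open>|V\<^sub>n|\<^sup>2 - |F\<^sub>n|\<^sup>2\<close> telescopes (\<open>blaschke_energy\<close>); hence multiplying
by \<open>\<beta>\<close> does not increase the norm, and dividing by \<open>\<beta>\<close> does not either as soon as \<open>W\<^sub>n \<longlongrightarrow> 0\<close>,
which can be arranged exactly when \<open>F\<close> has the root \<open>- a\<close>. And the functions \<open>f, v\<close> with series
\<open>F, V\<close> satisfy \<open>f(z + u) = 2 u v(z) + (2 - u) f(z)\<close> (\<open>dseries_unit_step\<close>); hence \<open>f\<close>
vanishes on a rectangle if \<open>v\<close> vanishes on the rectangle with one row less and \<open>f\<close> on the bottom row,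
and \<open>v\<close> vanishes on the smaller rectangle if \<open>f\<close> does on the larger. The root \<open>- a\<close> of \<open>F\<close> that is
needed to form \<open>V\<close> comes from \<open>f(0) = f(u) = 0\<close> (\<open>root_of_vanishing\<close>). Vanishing on a bottom row of
\<open>x + 1\<close> points means divisibility by \<open>X\<^sup>x\<^sup>+\<^sup>1\<close>. So \<open>g = X\<^sup>x\<^sup>+\<^sup>1 \<beta>\<^sup>m\<close> is the series of an element of
norm at most 1 of the range of \<open>f \<mapsto> B \<odot> f\<close>, and every element of that range is \<open>g\<close> times an
\<open>l\<^sup>2\<close> series of no larger norm.

A Schur function \<open>B\<close> is itself a series in the \<open>z\<^sup>(\<^sup>n\<^sup>)\<close> with bounded coefficients: positivity of its kernel
makes \<open>G\<^sub>z \<mapsto> B(z)\<close> a contractive functional, and each \<open>X\<^sup>n\<close> is a combination of the \<open>G\<^sub>j = (1 + X)\<^sup>j\<close>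
(\<open>Schur_function_expansion\<close>). Let \<open>b\<close> be its series. Since \<open>B = B \<odot> 1\<close> and \<open>g\<close> both lie in the range,
\<open>b = g V\<close> and \<open>g = b U\<close>, where \<open>U\<close> and \<open>V\<close> have norm at most 1. Then \<open>U V = 1\<close>, so their constant terms
have modulus 1 and exhaust their norms; \<open>V\<close> is a unimodular constant.
\<close>

unbundle no vec_syntax
unbundle fps_syntax

section \<open>Generating functions of the basis polynomials\<close>

definition lin :: "complex \<Rightarrow> complex fps" where
  "lin a = 1 + fps_const a * fps_X"

text \<open>
The generating function of the values \<open>z\<^sup>(\<^sup>n\<^sup>)\<close> at \<open>z\<close>. The last factor is the reciprocal of the
middle one, so that the exponent \<open>Im z\<close> may be negative; at most one of the two is present.
\<close>

definition lattice_gf :: "complex \<Rightarrow> complex fps" where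
  "lattice_gf z = (1 + fps_X) ^ nat \<lfloor>Re z\<rfloor> *
     (lin alpha_plus * inverse (lin alpha_minus)) ^ nat \<lfloor>Im z\<rfloor> *
     (lin alpha_minus * inverse (lin alpha_plus)) ^ nat \<lfloor>- Im z\<rfloor>"

lemma lin_inverse: "lin a * inverse (lin a) = 1" "inverse (lin a) * lin a = 1"
proof -
  have "lin a $ 0 \<noteq> 0" by (simp add: lin_def)
  from inverse_mult_eq_1[OF this] show "inverse (lin a) * lin a = 1" .
  thus "lin a * inverse (lin a) = 1" by (simp add: mult.commute)
qed

lemma lin_divide: "lin a * F = G \<Longrightarrow> F = G * inverse (lin a)"
proof -
  assume G: "lin a * F = G"
  have "G * inverse (lin a) = F * (lin a * inverse (lin a))"
    unfolding G[symmetric] by (simp only: mult_ac)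
  thus ?thesis by (simp only: lin_inverse mult_1_right)
qed

lemma lin_nth_0 [simp]: "lin a $ 0 = 1"
  by (simp add: lin_def)

lemma lin_mult_nth_Suc: "(lin a * F) $ Suc n = F $ Suc n + a * F $ n"
  by (simp add: lin_def ring_distribs mult.assoc)

lemma lattice_plusE:
  assumes "z \<in> \<Lambda>\<^sub>+"
  obtains a :: nat and y :: int where "z = Complex (real a) (of_int y)"
proof -
  from assms obtain x y :: int where xy: "Re z = of_int x" "Im z = of_int y" and "Re z \<ge> 0"
    by (auto simp: lattice_plus_def elim!: Ints_cases)
  hence "Re z = real (nat x)" by simp
  with xy have "z = Complex (real (nat x)) (of_int y)" by (simp add: complex_eq_iff)
  thus ?thesis by (rule that)
qed

lemma lattice_plus_Complex: "Complex (real a) (of_int y) \<in> \<Lambda>\<^sub>+"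
  by (simp add: lattice_plus_def)

lemma lattice_gf_Complex:
  "lattice_gf (Complex (real a) (of_int y)) = (1 + fps_X) ^ a *
     (lin alpha_plus * inverse (lin alpha_minus)) ^ nat y *
     (lin alpha_minus * inverse (lin alpha_plus)) ^ nat (- y)"
  by (simp add: lattice_gf_def flip: of_int_minus)

lemma zero_in_lattice: "0 \<in> \<Lambda>\<^sub>+"
  by (simp add: lattice_plus_def)

lemma add_one_in_lattice: "z \<in> \<Lambda>\<^sub>+ \<Longrightarrow> z + 1 \<in> \<Lambda>\<^sub>+"
  by (simp add: lattice_plus_def)

lemma add_ii_in_lattice: "z \<in> \<Lambda>\<^sub>+ \<Longrightarrow> z + \<i> \<in> \<Lambda>\<^sub>+" "z \<in> \<Lambda>\<^sub>+ \<Longrightarrow> z - \<i> \<in> \<Lambda>\<^sub>+"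
  by (simp_all add: lattice_plus_def)

lemma lattice_gf_0: "lattice_gf 0 = 1"
  by (simp add: lattice_gf_def)

lemma lattice_gf_of_nat: "lattice_gf (of_nat n) = (1 + fps_X) ^ n"
  by (simp add: lattice_gf_def)

lemma lattice_gf_add_1:
  assumes "z \<in> \<Lambda>\<^sub>+"
  shows "lattice_gf (z + 1) = (1 + fps_X) * lattice_gf z"
proof -
  obtain a y where z: "z = Complex (real a) (of_int y)" by (rule lattice_plusE[OF assms])
  have "z + 1 = Complex (real (Suc a)) (of_int y)" by (simp add: z complex_eq_iff)
  thus ?thesis by (simp only: z lattice_gf_Complex) simp
qed

lemma lin_quotient_Suc:
  "lin b * (R * (lin a * inverse (lin b)) ^ Suc n * S) =
   lin a * (R * (lin a * inverse (lin b)) ^ n * S)"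
proof -
  have "lin b * (R * (lin a * inverse (lin b)) ^ Suc n * S) =
      (lin b * inverse (lin b)) * (lin a * (R * (lin a * inverse (lin b)) ^ n * S))"
    by (simp only: power_Suc mult_ac)
  thus ?thesis by (simp only: lin_inverse mult_1_left)
qed

text \<open>
Together with the recurrence for a step to the right, this is the discrete integration rule in generating-function
form: the coefficients of \<open>X\<^sup>n\<^sup>+\<^sup>1\<close> on both sides say how \<open>z\<^sup>(\<^sup>n\<^sup>+\<^sup>1\<^sup>)\<close> changes from \<open>z\<close> to \<open>z + i\<close>
in terms of \<open>z\<^sup>(\<^sup>n\<^sup>)\<close>.
\<close>

lemma lattice_gf_add_ii:
  assumes "z \<in> \<Lambda>\<^sub>+"
  shows "lin alpha_minus * lattice_gf (z + \<i>) = lin alpha_plus * lattice_gf z"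
proof -
  obtain a y where z: "z = Complex (real a) (of_int y)" by (rule lattice_plusE[OF assms])
  have z1: "Complex (real a) (of_int y) + \<i> = Complex (real a) (of_int (y + 1))"
    by (simp add: complex_eq_iff)
  show ?thesis
  proof (cases "y \<ge> 0")
    case True
    hence "nat (y + 1) = Suc (nat y)" "nat (- y) = 0" "nat (- (y + 1)) = 0" by auto
    thus ?thesis by (simp only: z1 lattice_gf_Complex z lin_quotient_Suc)
  next
    case False
    hence "nat (- y) = Suc (nat (- (y + 1)))" "nat y = 0" "nat (y + 1) = 0" by auto
    thus ?thesis
      using lin_quotient_Suc[of alpha_plus "(1 + fps_X) ^ a" alpha_minus "nat (- (y + 1))" 1]
      by (simp only: z1 lattice_gf_Complex z power_0 mult_1_right)
  qed
qed

lemma lattice_gf_nth_0: "lattice_gf z $ 0 = 1"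
  by (simp add: lattice_gf_def lin_def fps_power_zeroth)

section \<open>Iterates of the integration operator\<close>

lemma path_sum_telescope:
  assumes step: "\<And>u v. u \<in> \<Lambda>\<^sub>+ \<Longrightarrow> v \<in> \<Lambda>\<^sub>+ \<Longrightarrow> cmod (v - u) = 1 \<Longrightarrow>
      (f u + f v) / 2 * (v - u) = F v - F u"
    and path: "lattice_path \<gamma> a b"
  shows "path_sum \<gamma> f = F b - (F a :: complex)"
proof -
  have ne: "\<gamma> \<noteq> []" and hd: "hd \<gamma> = a" and lst: "last \<gamma> = b" and sub: "set \<gamma> \<subseteq> \<Lambda>\<^sub>+"
    and dist: "\<And>k. k \<in> {1..<length \<gamma>} \<Longrightarrow> cmod (\<gamma> ! k - \<gamma> ! (k - 1)) = 1"
    using path by (auto simp: lattice_path_def)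
  have "path_sum \<gamma> f = (\<Sum>k\<in>{1..<length \<gamma>}. F (\<gamma> ! k) - F (\<gamma> ! (k - 1)))"
    unfolding path_sum_def using sub
    by (intro sum.cong refl step dist) (auto simp: subset_iff)
  also have "\<dots> = (\<Sum>k<length \<gamma> - 1. F (\<gamma> ! Suc k) - F (\<gamma> ! k))"
    by (rule sum.reindex_bij_witness[of _ Suc "\<lambda>k. k - 1"]) auto
  also have "\<dots> = F (\<gamma> ! (length \<gamma> - 1)) - F (\<gamma> ! 0)"
    by (rule sum_lessThan_telescope)
  finally show ?thesis using ne hd lst by (simp add: hd_conv_nth last_conv_nth)
qed

lemma lattice_path_extend:
  assumes "lattice_path \<gamma> a b" "c \<in> \<Lambda>\<^sub>+" "cmod (c - b) = 1"
  shows "lattice_path (\<gamma> @ [c]) a c"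
proof -
  have "cmod ((\<gamma> @ [c]) ! k - (\<gamma> @ [c]) ! (k - 1)) = 1" if "k \<in> {1..<length (\<gamma> @ [c])}" for k
  proof (cases "k = length \<gamma>")
    case True
    thus ?thesis using assms that by (auto simp: lattice_path_def nth_append last_conv_nth)
  next
    case False
    thus ?thesis using assms that by (auto simp: lattice_path_def nth_append)
  qed
  thus ?thesis using assms by (auto simp: lattice_path_def)
qed

lemma lattice_path_exists:
  assumes "z \<in> \<Lambda>\<^sub>+"
  shows "\<exists>\<gamma>. lattice_path \<gamma> 0 z"
proof -
  have real: "\<exists>\<gamma>. lattice_path \<gamma> 0 (Complex (real a) 0)" for a
  proof (induction a)
    case 0
    have "lattice_path [0] 0 (Complex (real 0) 0)"
      by (auto simp: lattice_path_def zero_in_lattice complex_eq_iff)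
    thus ?case ..
  next
    case (Suc a)
    then obtain \<gamma> where "lattice_path \<gamma> 0 (Complex (real a) 0)" ..
    moreover have "Complex (real (Suc a)) 0 \<in> \<Lambda>\<^sub>+" by (simp add: lattice_plus_def)
    moreover have "cmod (Complex (real (Suc a)) 0 - Complex (real a) 0) = 1"
      by (simp add: cmod_def)
    ultimately show ?case by (blast dest: lattice_path_extend)
  qed
  obtain a y where z: "z = Complex (real a) (of_int y)" by (rule lattice_plusE[OF assms])
  have "\<exists>\<gamma>. lattice_path \<gamma> 0 (Complex (real a) (of_int y))"
  proof (induction y rule: int_induct[where k = 0])
    case base
    show ?case using real by simp
  next
    case (step1 i)
    then obtain \<gamma> where "lattice_path \<gamma> 0 (Complex (real a) (of_int i))" by blast
    from lattice_path_extend[OF this lattice_plus_Complex[of a "i + 1"]]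
    show ?case by (auto simp: cmod_def)
  next
    case (step2 i)
    then obtain \<gamma> where "lattice_path \<gamma> 0 (Complex (real a) (of_int i))" by blast
    from lattice_path_extend[OF this lattice_plus_Complex[of a "i - 1"]]
    show ?case by (auto simp: cmod_def)
  qed
  thus ?thesis by (simp add: z)
qed

text \<open>
A function whose increments along all lattice edges are the trapezoidal terms makes every path sum
telescope, which gives path independence and the common value at once.
\<close>

lemma discrete_integral_primitive:
  assumes "\<And>u v. u \<in> \<Lambda>\<^sub>+ \<Longrightarrow> v \<in> \<Lambda>\<^sub>+ \<Longrightarrow> cmod (v - u) = 1 \<Longrightarrow>
      (f u + f v) / 2 * (v - u) = F v - F u"
    and "z \<in> \<Lambda>\<^sub>+"
  shows "discrete_integral 0 z f = F z - (F 0 :: complex)"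
proof -
  obtain \<gamma> where \<gamma>: "lattice_path \<gamma> 0 z" using lattice_path_exists[OF assms(2)] ..
  have eq: "path_sum \<gamma>' f = F z - F 0" if "lattice_path \<gamma>' 0 z" for \<gamma>'
    using assms(1) that by (rule path_sum_telescope)
  show ?thesis unfolding discrete_integral_def
  proof (rule the_equality)
    show "\<forall>\<gamma>. lattice_path \<gamma> 0 z \<longrightarrow> path_sum \<gamma> f = F z - F 0" using eq by blast
    show "I = F z - F 0" if "\<forall>\<gamma>. lattice_path \<gamma> 0 z \<longrightarrow> path_sum \<gamma> f = I" for I
      using that \<gamma> eq[OF \<gamma>] by simp
  qed
qed

lemma lattice_neighbours:
  assumes "u \<in> \<Lambda>\<^sub>+" "v \<in> \<Lambda>\<^sub>+" "cmod (v - u) = 1"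
  shows "v = u + 1 \<or> u = v + 1 \<or> v = u + \<i> \<or> u = v + \<i>"
proof -
  obtain a y where u: "u = Complex (real a) (of_int y)" by (rule lattice_plusE[OF assms(1)])
  obtain b x where v: "v = Complex (real b) (of_int x)" by (rule lattice_plusE[OF assms(2)])
  define p where "p = int b - int a"
  define q where "q = x - y"
  have "(real_of_int p)\<^sup>2 + (real_of_int q)\<^sup>2 = 1"
    using assms(3) by (simp add: u v cmod_def p_def q_def)
  hence pq: "p\<^sup>2 + q\<^sup>2 = 1" by (simp flip: of_int_power of_int_add)
  hence "p\<^sup>2 \<le> 1\<^sup>2" "q\<^sup>2 \<le> 1\<^sup>2" by (smt (verit) zero_le_power2 one_power2)+
  hence "\<bar>p\<bar> \<le> 1" "\<bar>q\<bar> \<le> 1" by (simp_all only: abs_le_square_iff[symmetric] abs_one)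
  hence "p \<in> {-1, 0, 1}" "q \<in> {-1, 0, 1}" by auto
  hence "(p = 1 \<and> q = 0) \<or> (p = -1 \<and> q = 0) \<or> (p = 0 \<and> q = 1) \<or> (p = 0 \<and> q = -1)"
    using pq by auto
  thus ?thesis
    by (auto simp: u v complex_eq_iff p_def q_def)
qed

text \<open>
The two edge recurrences of the generating function say that the next coefficient, corrected by half of the present
one, is a primitive of the present one.
\<close>

lemma Zop_lattice_gf:
  "Zop (\<lambda>z\<in>\<Lambda>\<^sub>+. lattice_gf z $ n) = (\<lambda>z\<in>\<Lambda>\<^sub>+. lattice_gf z $ Suc n)"
proof -
  define f where "f = (\<lambda>z\<in>\<Lambda>\<^sub>+. lattice_gf z $ n)"
  (* Z f is the integral of f plus (f 0 - f z) / 2, so a primitive of f is the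
     next coefficient plus f / 2. *)
  define F where "F = (\<lambda>z. lattice_gf z $ Suc n + lattice_gf z $ n / 2)"
  have one: "(f u + f (u + 1)) / 2 = F (u + 1) - F u" if "u \<in> \<Lambda>\<^sub>+" for u
  proof -
    have "lattice_gf (u + 1) $ Suc n = lattice_gf u $ Suc n + lattice_gf u $ n"
      by (simp add: lattice_gf_add_1[OF that] ring_distribs)
    thus ?thesis using that add_one_in_lattice[OF that]
      by (simp add: f_def F_def diff_divide_distrib add_divide_distrib)
  qed
  have ii: "(f u + f (u + \<i>)) / 2 * \<i> = F (u + \<i>) - F u" if "u \<in> \<Lambda>\<^sub>+" for u
  proof -
    have "lattice_gf (u + \<i>) $ Suc n =
        lattice_gf u $ Suc n + alpha_plus * lattice_gf u $ n - alpha_minus * lattice_gf (u + \<i>) $ n"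
      using arg_cong[OF lattice_gf_add_ii[OF that], of "\<lambda>F. F $ Suc n"]
      by (simp add: lin_mult_nth_Suc eq_diff_eq)
    moreover have "(A + A') / 2 * \<i> =
        (S + alpha_plus * A - alpha_minus * A' + A' / 2) - (S + A / 2)" for A A' S
      by (simp add: alpha_plus_def alpha_minus_def complex_eq_iff field_simps)
    ultimately show ?thesis using that add_ii_in_lattice(1)[OF that]
      by (simp only: f_def F_def restrict_apply if_True)
  qed
  have "(f u + f v) / 2 * (v - u) = F v - F u"
    if u: "u \<in> \<Lambda>\<^sub>+" and v: "v \<in> \<Lambda>\<^sub>+" and uv: "cmod (v - u) = 1" for u v
    using lattice_neighbours[OF u v uv]
  proof (elim disjE)
    assume "v = u + 1"
    thus ?thesis using one[OF u] by simp
  next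
    assume "u = v + 1"
    thus ?thesis using one[OF v] by (simp add: field_simps)
  next
    assume "v = u + \<i>"
    thus ?thesis using ii[OF u] by simp
  next
    assume *: "u = v + \<i>"
    have "(f u + f v) / 2 * (v - u) = - ((f v + f (v + \<i>)) / 2 * \<i>)"
      by (simp add: * field_simps)
    also have "\<dots> = F v - F u" by (simp only: ii[OF v] * minus_diff_eq)
    finally show ?thesis .
  qed
  hence int: "discrete_integral 0 z f = F z - F 0" if "z \<in> \<Lambda>\<^sub>+" for z
    using that by (rule discrete_integral_primitive)
  have "(f 0 - f z) / 2 + discrete_integral 0 z f = lattice_gf z $ Suc n" if "z \<in> \<Lambda>\<^sub>+" for z
    using that by (simp add: int) (simp add: f_def F_def zero_in_lattice lattice_gf_0 field_simps)
  hence "Zop f = (\<lambda>z\<in>\<Lambda>\<^sub>+. lattice_gf z $ Suc n)"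
    unfolding Zop_def by (intro restrict_ext)
  thus ?thesis by (simp only: f_def)
qed

lemma dpow_eq_restrict: "dpow n = (\<lambda>z\<in>\<Lambda>\<^sub>+. lattice_gf z $ n)"
proof (induction n)
  case 0
  show ?case by (simp add: dpow_def one_plus_def lattice_gf_nth_0)
next
  case (Suc n)
  have "dpow (Suc n) = Zop (dpow n)" by (simp add: dpow_def)
  thus ?case by (simp only: Suc Zop_lattice_gf)
qed

lemma dpow_eq: "z \<in> \<Lambda>\<^sub>+ \<Longrightarrow> dpow n z = lattice_gf z $ n"
  by (simp add: dpow_eq_restrict)

section \<open>Summability of power series\<close>

abbreviation abs_summable_fps :: "complex fps \<Rightarrow> bool" where
  "abs_summable_fps F \<equiv> summable (\<lambda>n. cmod (F $ n))"

lemma abs_summable_fps_finite: "(\<And>n. n > N \<Longrightarrow> F $ n = 0) \<Longrightarrow> abs_summable_fps F"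
  by (rule summable_finite[of "{..N}"]) simp_all

lemma abs_summable_fps_1: "abs_summable_fps 1"
  by (rule abs_summable_fps_finite[of 0]) auto

lemma abs_summable_fps_X_power: "abs_summable_fps (fps_X ^ k)"
  by (rule abs_summable_fps_finite[of k]) (auto simp: fps_X_power_nth)

lemma abs_summable_fps_lin: "abs_summable_fps (lin a)"
  by (rule abs_summable_fps_finite[of 1]) (simp add: lin_def)

lemma abs_summable_fps_mult:
  assumes "abs_summable_fps F" "abs_summable_fps G"
  shows "abs_summable_fps (F * G)"
proof (rule summable_comparison_test')
  show "summable (\<lambda>n. \<Sum>i\<le>n. cmod (F $ i) * cmod (G $ (n - i)))"
    using summable_Cauchy_product[of "\<lambda>n. cmod (F $ n)" "\<lambda>n. cmod (G $ n)"] assms by simp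
  show "norm (cmod ((F * G) $ n)) \<le> (\<Sum>i\<le>n. cmod (F $ i) * cmod (G $ (n - i)))" for n
    using norm_sum[of "\<lambda>i. F $ i * G $ (n - i)" "{..n}"]
    by (simp add: fps_mult_nth norm_mult flip: atMost_atLeast0)
qed

lemma abs_summable_fps_power: "abs_summable_fps F \<Longrightarrow> abs_summable_fps (F ^ k)"
  by (induction k) (simp_all only: power_0 power_Suc abs_summable_fps_1 abs_summable_fps_mult)

lemma inverse_lin_nth: "inverse (lin a) $ n = (- a) ^ n"
proof -
  define G where "G = Abs_fps (\<lambda>n. (- a) ^ n)"
  have "(lin a * G) $ n = 1 $ n" for n
    by (cases n) (simp_all add: lin_mult_nth_Suc G_def)
  hence "lin a * G = 1" by (simp add: fps_eq_iff)
  hence "G = 1 * inverse (lin a)" by (rule lin_divide)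
  hence "inverse (lin a) = G" by simp
  thus ?thesis by (simp add: G_def)
qed

lemma abs_summable_fps_inverse_lin: "cmod a < 1 \<Longrightarrow> abs_summable_fps (inverse (lin a))"
  by (simp add: inverse_lin_nth norm_power summable_geometric)

lemma cmod_alpha: "cmod alpha_plus < 1" "cmod alpha_minus < 1"
proof -
  have "sqrt 2 < 2" using real_sqrt_less_mono[of 2 4] by simp
  thus "cmod alpha_plus < 1" "cmod alpha_minus < 1"
    by (simp_all add: alpha_plus_def alpha_minus_def norm_divide) (simp_all add: cmod_def)
qed

lemma abs_summable_lattice_gf: "abs_summable_fps (lattice_gf z)"
proof -
  have "1 + fps_X = lin 1" by (simp add: lin_def)
  thus ?thesis unfolding lattice_gf_def
    by (simp only:) (intro abs_summable_fps_mult abs_summable_fps_power abs_summable_fps_lin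
      abs_summable_fps_inverse_lin cmod_alpha)
qed

abbreviation bounded_fps :: "complex fps \<Rightarrow> bool" where
  "bounded_fps F \<equiv> Bseq (fps_nth F)"

abbreviation sq_summable_fps :: "complex fps \<Rightarrow> bool" where
  "sq_summable_fps F \<equiv> summable (\<lambda>n. (cmod (F $ n))\<^sup>2)"

lemma abs_summable_imp_bounded: "abs_summable_fps F \<Longrightarrow> bounded_fps F"
  by (rule convergent_imp_Bseq, rule convergentI, rule summable_LIMSEQ_zero, rule summable_norm_cancel)

lemma sq_summable_imp_tendsto_0: "sq_summable_fps F \<Longrightarrow> fps_nth F \<longlonglongrightarrow> 0"
proof -
  assume "sq_summable_fps F"
  hence "(\<lambda>n. sqrt ((cmod (F $ n))\<^sup>2)) \<longlonglongrightarrow> sqrt 0"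
    by (intro tendsto_real_sqrt summable_LIMSEQ_zero)
  thus ?thesis by (simp add: tendsto_norm_zero_iff)
qed

lemma sq_summable_imp_bounded: "sq_summable_fps F \<Longrightarrow> bounded_fps F"
  by (rule convergent_imp_Bseq, rule convergentI, rule sq_summable_imp_tendsto_0)

lemma abs_summable_imp_sq_summable:
  assumes "abs_summable_fps F"
  shows "sq_summable_fps F"
proof -
  obtain C where C: "\<And>n. cmod (F $ n) \<le> C"
    using abs_summable_imp_bounded[OF assms] by (auto simp: Bseq_def)
  show ?thesis
  proof (rule summable_comparison_test')
    show "summable (\<lambda>n. C * cmod (F $ n))" using assms by (rule summable_mult)
    show "norm ((cmod (F $ n))\<^sup>2) \<le> C * cmod (F $ n)" for n
      using C[of n] by (simp add: power2_eq_square mult_right_mono)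
  qed
qed

lemma abs_summable_bounded_times:
  assumes "bounded_fps F" "abs_summable_fps G"
  shows "summable (\<lambda>n. cmod (F $ n * G $ n))"
proof -
  obtain C where C: "\<And>n. cmod (F $ n) \<le> C" using assms(1) by (auto simp: Bseq_def)
  show ?thesis
  proof (rule summable_comparison_test')
    show "summable (\<lambda>n. C * cmod (G $ n))" using assms(2) by (rule summable_mult)
    show "norm (cmod (F $ n * G $ n)) \<le> C * cmod (G $ n)" for n
      using C[of n] by (simp add: norm_mult mult_right_mono)
  qed
qed

section \<open>Series in the basis polynomials and the Hardy space\<close>

definition dseries :: "complex fps \<Rightarrow> complex \<Rightarrow> complex" where
  "dseries F = (\<lambda>z\<in>\<Lambda>\<^sub>+. \<Sum>n. F $ n * dpow n z)"

lemma dseries_sums: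
  assumes "bounded_fps F" "z \<in> \<Lambda>\<^sub>+"
  shows "(\<lambda>n. F $ n * lattice_gf z $ n) sums dseries F z"
  using summable_norm_cancel[OF abs_summable_bounded_times[OF assms(1) abs_summable_lattice_gf]] assms(2)
  by (simp add: dseries_def dpow_eq summable_sums)

lemma has_expansion_imp_dseries: "has_expansion f a \<Longrightarrow> f = dseries (Abs_fps a)"
  by (rule extensionalityI[of _ "\<Lambda>\<^sub>+"])
     (auto simp: has_expansion_def dseries_def sums_iff)

lemma has_expansion_dseries:
  assumes "bounded_fps F"
  shows "has_expansion (dseries F) (fps_nth F)"
proof -
  obtain C where C: "C > 0" "\<And>n. cmod (F $ n) \<le> C" using assms by (auto simp: Bseq_def)
  have "limsup (\<lambda>n. ereal (root n (cmod (F $ n)))) \<le> limsup (\<lambda>n. ereal (root n C))"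
    by (intro Limsup_mono eventually_mono[OF eventually_gt_at_top[of 0]])
       (simp add: C(2) real_root_le_mono)
  also have "\<dots> = ereal 1"
    using LIMSEQ_root_const[OF C(1)] by (intro lim_imp_Limsup) auto
  also have "\<dots> < ereal (sqrt 2)" by simp
  finally show ?thesis
    using dseries_sums[OF assms] by (simp add: has_expansion_def dseries_def dpow_eq)
qed

lemma of_nat_in_lattice: "of_nat j \<in> \<Lambda>\<^sub>+"
  by (simp add: lattice_plus_def)

lemma dpow_of_nat: "dpow n (of_nat j) = of_nat (j choose n)"
proof -
  have "(1 + fps_X :: complex fps) ^ j $ n = of_nat (j choose n)"
  proof (induction j arbitrary: n)
    case (Suc j)
    thus ?case by (cases n) (simp_all add: ring_distribs)
  qed (cases n, simp_all)
  thus ?thesis by (simp add: dpow_eq of_nat_in_lattice lattice_gf_of_nat)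
qed

lemma binomial_transform_inject:
  fixes a b :: "nat \<Rightarrow> complex"
  assumes "\<And>j. (\<Sum>n\<le>j. a n * of_nat (j choose n)) = (\<Sum>n\<le>j. b n * of_nat (j choose n))"
  shows "a = b"
proof
  show "a j = b j" for j
  proof (induction j rule: less_induct)
    case (less j)
    have "(\<Sum>n<j. a n * of_nat (j choose n)) = (\<Sum>n<j. b n * of_nat (j choose n))"
      using less by (intro sum.cong) auto
    thus ?case using assms[of j] by (simp flip: lessThan_Suc_atMost)
  qed
qed

text \<open>
At a nonnegative integer \<open>j\<close> only the terms with \<open>n \<le> j\<close> survive, so the values there determine
the coefficients by a triangular system, and \<open>dseries F\<close> is a finite sum there for every \<open>F\<close>. This
is what identifies the coefficients of a convolution product once the product is known to lie in the
Hardy space.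
\<close>

lemma has_expansion_unique:
  assumes "has_expansion (dseries F) a"
  shows "a = fps_nth F"
proof (rule binomial_transform_inject)
  fix j
  have fin: "(\<lambda>n. c n * dpow n (of_nat j)) sums (\<Sum>n\<le>j. c n * of_nat (j choose n))" for c
    unfolding dpow_of_nat by (rule sums_finite) auto
  have "(\<lambda>n. a n * dpow n (of_nat j)) sums dseries F (of_nat j)"
    using assms by (simp add: has_expansion_def of_nat_in_lattice)
  hence "(\<Sum>n\<le>j. a n * of_nat (j choose n)) = dseries F (of_nat j)"
    using fin sums_unique2 by blast
  also have "\<dots> = (\<Sum>n\<le>j. F $ n * of_nat (j choose n))"
    using fin[of "fps_nth F"] by (simp add: dseries_def of_nat_in_lattice sums_iff)
  finally show "(\<Sum>n\<le>j. a n * of_nat (j choose n)) = (\<Sum>n\<le>j. F $ n * of_nat (j choose n))" .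
qed

lemma coeffs_of_eqI:
  assumes "has_expansion (dseries F) a"
  shows "coeffs_of (dseries F) = fps_nth F"
  unfolding coeffs_of_def
proof (rule the_equality)
  show "has_expansion (dseries F) (fps_nth F)"
    using assms has_expansion_unique[OF assms] by simp
qed (rule has_expansion_unique)

lemma coeffs_of_dseries: "bounded_fps F \<Longrightarrow> coeffs_of (dseries F) = fps_nth F"
  by (rule coeffs_of_eqI[OF has_expansion_dseries])

text \<open>
From left to right, membership supplies some expansion, and uniqueness identifies its coefficients
with those of \<open>F\<close>; from right to left, square-summable coefficients are bounded.
\<close>

lemma dseries_in_Hardy_iff: "dseries F \<in> Hardy \<longleftrightarrow> sq_summable_fps F"
proof
  assume "dseries F \<in> Hardy"
  thus "sq_summable_fps F" by (auto simp: Hardy_def coeffs_of_eqI)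
next
  assume "sq_summable_fps F"
  thus "dseries F \<in> Hardy"
    using has_expansion_dseries[OF sq_summable_imp_bounded] coeffs_of_dseries[OF sq_summable_imp_bounded]
    by (auto simp: Hardy_def)
qed

lemma HardyE:
  assumes "f \<in> Hardy"
  obtains F where "sq_summable_fps F" "f = dseries F"
proof -
  obtain a where "has_expansion f a" using assms by (auto simp: Hardy_def)
  hence "f = dseries (Abs_fps a)" by (rule has_expansion_imp_dseries)
  thus ?thesis using that[of "Abs_fps a"] assms by (simp add: dseries_in_Hardy_iff)
qed

lemma Hardy_norm_dseries:
  assumes "sq_summable_fps F"
  shows "Hardy_norm (dseries F) = sqrt (\<Sum>n. (cmod (F $ n))\<^sup>2)"
proof -
  have "(\<lambda>n. of_real ((cmod (F $ n))\<^sup>2) :: complex) sums of_real (\<Sum>n. (cmod (F $ n))\<^sup>2)"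
    using assms by (intro sums_of_real summable_sums)
  hence "Hardy_inner (dseries F) (dseries F) = of_real (\<Sum>n. (cmod (F $ n))\<^sup>2)"
    unfolding Hardy_inner_def coeffs_of_dseries[OF sq_summable_imp_bounded[OF assms]]
    by (simp only: complex_norm_square sums_iff)
  thus ?thesis by (simp add: Hardy_norm_def)
qed

lemma dconv_dseries:
  assumes "bounded_fps F" "bounded_fps G"
  shows "dseries F \<odot> dseries G = dseries (F * G)"
  unfolding dconv_def dseries_def[of "F * G"]
  using assms by (simp add: coeffs_of_dseries fps_mult_nth atMost_atLeast0)

lemma one_plus_eq_dseries: "one_plus = dseries 1"
proof -
  have "(\<Sum>n. 1 $ n * dpow n z) = 1" if "z \<in> \<Lambda>\<^sub>+" for z
    using sums_finite[of "{0}" "\<lambda>n. 1 $ n * dpow n z"] that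
    by (simp add: sums_iff dpow_eq lattice_gf_nth_0)
  thus ?thesis unfolding one_plus_def dseries_def by (intro restrict_ext) simp
qed

lemma dpow_eq_dseries: "dpow k = dseries (fps_X ^ k)"
proof -
  have "(\<Sum>n. (fps_X ^ k :: complex fps) $ n * dpow n z) = lattice_gf z $ k" if "z \<in> \<Lambda>\<^sub>+" for z
    using sums_finite[of "{k}" "\<lambda>n. (fps_X ^ k :: complex fps) $ n * dpow n z"] that
    by (simp add: sums_iff dpow_eq fps_X_power_nth)
  thus ?thesis unfolding dpow_eq_restrict[of k] dseries_def by (intro restrict_ext) simp
qed

lemma dconv_power_dseries:
  assumes "abs_summable_fps F"
  shows "dconv_power (dseries F) k = dseries (F ^ k)"
proof (induction k)
  case 0
  show ?case by (simp add: dconv_power_def one_plus_eq_dseries)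
next
  case (Suc k)
  have "dconv_power (dseries F) (Suc k) = dseries F \<odot> dconv_power (dseries F) k"
    by (simp add: dconv_power_def)
  thus ?case
    by (simp add: Suc dconv_dseries abs_summable_imp_bounded abs_summable_fps_power assms)
qed

section \<open>Expansion of Schur functions\<close>

lemma summable_mult_cnj:
  fixes f g :: "nat \<Rightarrow> complex"
  assumes "summable (\<lambda>n. (cmod (f n))\<^sup>2)" "summable (\<lambda>n. (cmod (g n))\<^sup>2)"
  shows "summable (\<lambda>n. f n * cnj (g n))"
proof (rule summable_comparison_test')
  show "summable (\<lambda>n. (cmod (f n))\<^sup>2 + (cmod (g n))\<^sup>2)" using assms by (rule summable_add)
  show "norm (f n * cnj (g n)) \<le> (cmod (f n))\<^sup>2 + (cmod (g n))\<^sup>2" for n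
    using sum_squares_bound[of "cmod (f n)" "cmod (g n)"]
      mult_nonneg_nonneg[OF norm_ge_zero[of "f n"] norm_ge_zero[of "g n"]]
    unfolding norm_mult complex_mod_cnj by linarith
qed

lemma double_sum_mult_cnj:
  fixes c f :: "'i \<Rightarrow> complex"
  shows "(\<Sum>j\<in>I. \<Sum>k\<in>I. c j * cnj (c k) * (f j * cnj (f k))) =
      of_real ((cmod (\<Sum>j\<in>I. c j * f j))\<^sup>2)"
  unfolding complex_norm_square cnj_sum sum_product by (simp add: mult_ac)

text \<open>
The quadratic form of the kernel is a sum over \<open>n\<close> of differences of squares
\<open>|A\<^sub>n|\<^sup>2 - |T\<^sub>n|\<^sup>2\<close>. Nonnegativity bounds the whole sum of the \<open>|T\<^sub>n|\<^sup>2\<close>, in particular its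
first term, which involves \<open>s\<close> itself rather than \<open>Z\<^sup>n s\<close>.
\<close>

lemma Schur_functional_bound_interval:
  fixes w c :: "nat \<Rightarrow> complex"
  assumes s: "Schur_function s" and N: "N \<ge> 1" and w: "\<And>j. j \<in> {1..N} \<Longrightarrow> w j \<in> \<Lambda>\<^sub>+"
  shows "(cmod (\<Sum>j=1..N. c j * s (w j)))\<^sup>2 \<le>
      (\<Sum>n. (cmod (\<Sum>j=1..N. c j * dpow n (w j)))\<^sup>2)"
proof -
  define A where "A n = (\<Sum>j=1..N. c j * dpow n (w j))" for n
  define T where "T n = (\<Sum>j=1..N. c j * (Zop ^^ n) s (w j))" for n
  have sqd: "summable (\<lambda>n. (cmod (dpow n z))\<^sup>2)" if "z \<in> \<Lambda>\<^sub>+" for z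
    using abs_summable_imp_sq_summable[OF abs_summable_lattice_gf[of z]] that by (simp add: dpow_eq)
  have sqs: "summable (\<lambda>n. (cmod ((Zop ^^ n) s z))\<^sup>2)" if "z \<in> \<Lambda>\<^sub>+" for z
    using s that by (simp add: Schur_function_def)
  have ker: "(\<lambda>n. dpow n (w j) * cnj (dpow n (w k)) - (Zop ^^ n) s (w j) * cnj ((Zop ^^ n) s (w k)))
      sums Schur_kernel s (w k) (w j)" if "j \<in> {1..N}" "k \<in> {1..N}" for j k
    unfolding Schur_kernel_def
    by (intro summable_sums summable_diff summable_mult_cnj sqd sqs w that)
  define S where "S = (\<Sum>j=1..N. \<Sum>k=1..N. c j * cnj (c k) * Schur_kernel s (w k) (w j))"
  have "(\<lambda>n. \<Sum>j=1..N. \<Sum>k=1..N. c j * cnj (c k) *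
      (dpow n (w j) * cnj (dpow n (w k)) - (Zop ^^ n) s (w j) * cnj ((Zop ^^ n) s (w k)))) sums S"
    unfolding S_def by (intro sums_sum sums_mult ker)
  moreover have "(\<Sum>j=1..N. \<Sum>k=1..N. c j * cnj (c k) *
      (dpow n (w j) * cnj (dpow n (w k)) - (Zop ^^ n) s (w j) * cnj ((Zop ^^ n) s (w k)))) =
      of_real ((cmod (A n))\<^sup>2 - (cmod (T n))\<^sup>2)" for n
    unfolding A_def T_def right_diff_distrib sum_subtractf double_sum_mult_cnj by simp
  ultimately have "(\<lambda>n. of_real ((cmod (A n))\<^sup>2 - (cmod (T n))\<^sup>2) :: complex) sums S"
    by (simp only:)
  from sums_Re[OF this] have diff: "(\<lambda>n. (cmod (A n))\<^sup>2 - (cmod (T n))\<^sup>2) sums Re S" by simp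
  have "S \<in> \<real>\<^sub>\<ge>\<^sub>0"
    using s N w unfolding Schur_function_def positive_kernel_def S_def by blast
  hence "Re S \<ge> 0" by (auto simp: nonneg_Reals_def)
  have A_eq: "A n = (\<Sum>j=1..N. fps_const (c j) * lattice_gf (w j)) $ n" for n
    by (simp add: A_def fps_sum_nth dpow_eq w)
  have "abs_summable_fps (\<Sum>j=1..N. fps_const (c j) * lattice_gf (w j))"
  proof (rule summable_comparison_test')
    show "summable (\<lambda>n. \<Sum>j=1..N. cmod (c j) * cmod (lattice_gf (w j) $ n))"
      by (intro summable_sum summable_mult abs_summable_lattice_gf)
    show "norm (cmod ((\<Sum>j=1..N. fps_const (c j) * lattice_gf (w j)) $ n)) \<le>
        (\<Sum>j=1..N. cmod (c j) * cmod (lattice_gf (w j) $ n))" for n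
      using norm_sum[of "\<lambda>j. c j * lattice_gf (w j) $ n" "{1..N}"]
      by (simp add: fps_sum_nth norm_mult)
  qed
  hence sqA: "summable (\<lambda>n. (cmod (A n))\<^sup>2)"
    unfolding A_eq by (rule abs_summable_imp_sq_summable)
  have T: "(\<lambda>n. (cmod (T n))\<^sup>2) sums ((\<Sum>n. (cmod (A n))\<^sup>2) - Re S)"
    using sums_diff[OF summable_sums[OF sqA] diff] by simp
  have "(cmod (T 0))\<^sup>2 \<le> (\<Sum>n. (cmod (T n))\<^sup>2)"
    using sum_le_suminf[OF sums_summable[OF T], of "{0}"] by simp
  also have "\<dots> \<le> (\<Sum>n. (cmod (A n))\<^sup>2)"
    using T \<open>Re S \<ge> 0\<close> by (simp add: sums_iff)
  finally show ?thesis by (simp add: A_def T_def)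
qed

text \<open>
In other words, \<open>G\<^sub>z \<mapsto> s(z)\<close> extends to a linear functional of \<open>l\<^sup>2\<close> norm at most 1 on the span of the
generating functions.
\<close>

lemma Schur_functional_bound:
  fixes w c :: "'i \<Rightarrow> complex"
  assumes s: "Schur_function s" and fin: "finite I" and w: "\<And>i. i \<in> I \<Longrightarrow> w i \<in> \<Lambda>\<^sub>+"
  shows "(cmod (\<Sum>i\<in>I. c i * s (w i)))\<^sup>2 \<le>
      (\<Sum>n. (cmod ((\<Sum>i\<in>I. fps_const (c i) * lattice_gf (w i)) $ n))\<^sup>2)"
proof (cases "I = {}")
  case False
  obtain h where h: "bij_betw h {1..card I} I" using ex_bij_betw_nat_finite_1[OF fin] by blast
  have re: "(\<Sum>j=1..card I. g (h j)) = sum g I" for g :: "'i \<Rightarrow> complex"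
    by (rule sum.reindex_bij_betw[OF h])
  have hw: "w (h j) \<in> \<Lambda>\<^sub>+" if "j \<in> {1..card I}" for j
    using bij_betwE[OF h] that w by blast
  have "card I \<ge> 1" using False fin by (simp add: Suc_leI card_gt_0_iff)
  from Schur_functional_bound_interval[where w = "\<lambda>j. w (h j)" and c = "\<lambda>j. c (h j)", OF s this hw]
  have "(cmod (\<Sum>i\<in>I. c i * s (w i)))\<^sup>2 \<le> (\<Sum>n. (cmod (\<Sum>i\<in>I. c i * dpow n (w i)))\<^sup>2)"
    by (simp only: re[of "\<lambda>i. c i * s (w i)"] re[of "\<lambda>i. c i * dpow _ (w i)"])
  also have "(\<Sum>n. (cmod (\<Sum>i\<in>I. c i * dpow n (w i)))\<^sup>2) =
      (\<Sum>n. (cmod ((\<Sum>i\<in>I. fps_const (c i) * lattice_gf (w i)) $ n))\<^sup>2)"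
    by (simp add: fps_sum_nth dpow_eq w)
  finally show ?thesis .
qed simp

text \<open>
The weights of the \<open>n\<close>-th forward difference at 0.
\<close>

definition newton_weight :: "nat \<Rightarrow> nat \<Rightarrow> complex" where
  "newton_weight n j = (- 1) ^ (n - j) * of_nat (n choose j)"

lemma sum_newton_weight:
  assumes "n < N"
  shows "(\<Sum>j<N. fps_const (newton_weight n j) * lattice_gf (of_nat j)) = fps_X ^ n"
proof -
  have "fps_X ^ n = ((1 + fps_X) + (- 1) :: complex fps) ^ n" by simp
  also have "\<dots> = (\<Sum>j\<le>n. of_nat (n choose j) * (1 + fps_X) ^ j * (- 1) ^ (n - j))"
    by (rule binomial_ring)
  also have "\<dots> = (\<Sum>j\<le>n. fps_const (newton_weight n j) * lattice_gf (of_nat j))"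
  proof (rule sum.cong)
    fix j
    have "fps_const (newton_weight n j) = (- 1) ^ (n - j) * of_nat (n choose j)"
      by (simp add: newton_weight_def fps_of_nat flip: fps_const_mult fps_const_power fps_const_neg)
    thus "of_nat (n choose j) * (1 + fps_X) ^ j * (- 1) ^ (n - j) =
        fps_const (newton_weight n j) * lattice_gf (of_nat j)"
      by (simp add: lattice_gf_of_nat mult_ac)
  qed simp
  also have "\<dots> = (\<Sum>j<N. fps_const (newton_weight n j) * lattice_gf (of_nat j))"
    using assms by (intro sum.mono_neutral_left) (auto simp: newton_weight_def)
  finally show ?thesis ..
qed

lemma fps_const_sum: "fps_const (sum g A) = (\<Sum>i\<in>A. fps_const (g i :: complex))"
  by (simp add: fps_eq_iff fps_sum_nth)

text \<open>
Applied to \<open>X\<^sup>n\<close>, the contractive functional \<open>G\<^sub>z \<mapsto> s(z)\<close> yields the Newton coefficient \<open>a\<^sub>n\<close>, of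
modulus at most 1. Applied to \<open>G\<^sub>z\<close> minus its Taylor polynomial of degree below \<open>M\<close>, it yields the remainder
of the expansion of \<open>s(z)\<close>, which is therefore at most the \<open>l\<^sup>2\<close> tail of \<open>G\<^sub>z\<close>.
\<close>

lemma Schur_function_expansion:
  assumes s: "Schur_function s"
  obtains F where "bounded_fps F" "s = dseries F"
proof -
  (* The forward differences of s at 0 along the real axis: the only candidates, since the
     basis polynomials take binomial coefficients as values there. *)
  define a where "a n = (\<Sum>j\<le>n. newton_weight n j * s (of_nat j))" for n
  have a_eq: "a n = (\<Sum>j<N. newton_weight n j * s (of_nat j))" if "n < N" for n N
    unfolding a_def using that by (intro sum.mono_neutral_left) (auto simp: newton_weight_def)
  have a_bound: "cmod (a n) \<le> 1" for n
  proof -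
    have "(\<lambda>m. (cmod ((fps_X ^ n :: complex fps) $ m))\<^sup>2) sums (\<Sum>m\<in>{n}. (cmod ((fps_X ^ n :: complex fps) $ m))\<^sup>2)"
      by (rule sums_finite) (auto simp: fps_X_power_nth)
    hence "(\<Sum>m. (cmod ((fps_X ^ n :: complex fps) $ m))\<^sup>2) = 1"
      by (simp add: sums_iff fps_X_power_nth)
    hence "(cmod (a n))\<^sup>2 \<le> 1"
      using Schur_functional_bound[OF s, of "{..<Suc n}" of_nat "newton_weight n"]
      by (simp only: finite_lessThan of_nat_in_lattice a_eq[OF lessI, symmetric]
          sum_newton_weight[OF lessI] simp_thms)
    thus ?thesis by (simp add: power_le_one_iff)
  qed
  have expansion: "(\<lambda>n. a n * lattice_gf z $ n) sums s z" if z: "z \<in> \<Lambda>\<^sub>+" for z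
  proof -
    define G where "G = lattice_gf z"
    define r where "r M = (\<Sum>n. (cmod (G $ n))\<^sup>2) - (\<Sum>n<M. (cmod (G $ n))\<^sup>2)" for M
    have sqG: "(\<lambda>n. (cmod (G $ n))\<^sup>2) sums (\<Sum>n. (cmod (G $ n))\<^sup>2)"
      unfolding G_def
      by (intro summable_sums abs_summable_imp_sq_summable abs_summable_lattice_gf)
    have rem: "(cmod (s z - (\<Sum>n<M. a n * G $ n)))\<^sup>2 \<le> r M" for M
    proof -
      define w where "w i = (if i < M then of_nat i else z)" for i
      (* The point z with weight 1, and the integers below M with the weights that cancel the
         first M coefficients of G. *)
      define c where "c i = (if i < M then - (\<Sum>n<M. G $ n * newton_weight n i) else 1)" for i
      have ev: "(\<Sum>i<Suc M. c i * s (w i)) = s z - (\<Sum>n<M. a n * G $ n)"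
      proof -
        have "(\<Sum>i<M. c i * s (w i)) = - (\<Sum>i<M. \<Sum>n<M. G $ n * newton_weight n i * s (of_nat i))"
          unfolding sum_negf[symmetric]
          by (intro sum.cong) (auto simp: c_def w_def sum_distrib_right sum_negf)
        also have "\<dots> = - (\<Sum>n<M. a n * G $ n)"
          by (subst sum.swap) (simp add: a_eq[of _ M] sum_distrib_right sum_distrib_left mult_ac)
        finally show ?thesis by (simp add: c_def w_def)
      qed
      have gf: "(\<Sum>i<Suc M. fps_const (c i) * lattice_gf (w i)) =
          G - (\<Sum>n<M. fps_const (G $ n) * fps_X ^ n)"
      proof -
        have "(\<Sum>i<M. fps_const (c i) * lattice_gf (w i)) =
            - (\<Sum>i<M. \<Sum>n<M. fps_const (G $ n) * (fps_const (newton_weight n i) * lattice_gf (of_nat i)))"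
          unfolding sum_negf[symmetric]
        proof (rule sum.cong)
          fix i assume "i \<in> {..<M}"
          thus "fps_const (c i) * lattice_gf (w i) = (\<Sum>n<M. - (fps_const (G $ n) *
              (fps_const (newton_weight n i) * lattice_gf (of_nat i))))"
            by (simp add: c_def w_def sum_negf mult.assoc[symmetric] fps_const_sum
                flip: sum_distrib_right fps_const_neg fps_const_mult)
        qed simp
        also have "\<dots> = - (\<Sum>n<M. fps_const (G $ n) *
            (\<Sum>i<M. fps_const (newton_weight n i) * lattice_gf (of_nat i)))"
          by (subst sum.swap) (simp add: sum_distrib_left)
        also have "\<dots> = - (\<Sum>n<M. fps_const (G $ n) * fps_X ^ n)"
          by (simp add: sum_newton_weight)
        finally show ?thesis by (simp add: c_def w_def G_def)
      qed
      have nth: "(cmod ((G - (\<Sum>n<M. fps_const (G $ n) * fps_X ^ n)) $ m))\<^sup>2 =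
          (cmod (G $ m))\<^sup>2 - (if m \<in> {..<M} then (cmod (G $ m))\<^sup>2 else 0)" for m
        by (simp add: fps_sum_nth fps_X_power_nth if_distrib[of "\<lambda>x. _ * x"] cong: if_cong)
      have "(\<lambda>m. (cmod ((G - (\<Sum>n<M. fps_const (G $ n) * fps_X ^ n)) $ m))\<^sup>2) sums r M"
        unfolding nth r_def by (intro sums_diff sqG sums_If_finite_set) simp
      thus ?thesis
        using Schur_functional_bound[OF s, of "{..<Suc M}" w c] z
        unfolding ev gf by (auto simp: w_def of_nat_in_lattice sums_iff)
    qed
    have "r \<longlonglongrightarrow> 0"
      using tendsto_diff[OF tendsto_const sqG[unfolded sums_def], of "\<Sum>n. (cmod (G $ n))\<^sup>2"]
      by (simp add: r_def[abs_def])
    hence "(\<lambda>M. sqrt (r M)) \<longlonglongrightarrow> 0" using tendsto_real_sqrt by fastforce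
    moreover have "\<forall>\<^sub>F M in sequentially. norm (s z - (\<Sum>n<M. a n * G $ n)) \<le> sqrt (r M)"
      using rem by (auto intro!: always_eventually real_le_rsqrt)
    ultimately have "(\<lambda>M. s z - (\<Sum>n<M. a n * G $ n)) \<longlonglongrightarrow> 0"
      by (rule Lim_null_comparison[rotated])
    hence "(\<lambda>M. s z - (s z - (\<Sum>n<M. a n * G $ n))) \<longlonglongrightarrow> s z - 0"
      by (intro tendsto_diff tendsto_const)
    thus ?thesis by (simp add: sums_def G_def)
  qed
  have "s \<in> extensional \<Lambda>\<^sub>+" using s by (simp add: Schur_function_def discrete_analytic_def)
  hence "s = dseries (Abs_fps a)"
    using expansion by (intro extensionalityI[of s "\<Lambda>\<^sub>+"]) (auto simp: dseries_def dpow_eq sums_iff)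
  moreover have "bounded_fps (Abs_fps a)" using a_bound by (intro BseqI'[of _ 1]) simp
  ultimately show ?thesis using that by blast
qed

section \<open>Multiplication and division by a Blaschke factor\<close>

definition blaschke :: "complex \<Rightarrow> complex fps" where
  "blaschke a = (fps_const a + fps_X) * inverse (lin (cnj a))"

lemma abs_summable_blaschke:
  assumes "cmod a < 1"
  shows "abs_summable_fps (blaschke a)"
proof -
  have "abs_summable_fps (fps_const a + fps_X)"
    by (rule abs_summable_fps_finite[of 1]) simp
  thus ?thesis unfolding blaschke_def using assms
    by (intro abs_summable_fps_mult abs_summable_fps_inverse_lin) simp_all
qed

text \<open>
Writing both \<open>V\<close> and its product with the Blaschke factor as polynomial multiples of one series \<open>W\<close> gives
coefficient relations without a quotient.
\<close>

lemma blaschke_multE: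
  obtains W where "lin (cnj a) * W = V" "(fps_const a + fps_X) * W = blaschke a * V"
proof (rule that[of "inverse (lin (cnj a)) * V"])
  show "lin (cnj a) * (inverse (lin (cnj a)) * V) = V"
    by (simp only: mult.assoc[symmetric] lin_inverse mult_1_left)
qed (simp add: blaschke_def mult_ac)

lemma blaschke_mult_lin: "blaschke a * (lin (cnj a) * W) = (fps_const a + fps_X) * W"
proof -
  have "blaschke a * (lin (cnj a) * W) =
      (fps_const a + fps_X) * W * (inverse (lin (cnj a)) * lin (cnj a))"
    by (simp only: blaschke_def mult_ac)
  thus ?thesis by (simp only: lin_inverse mult_1_right)
qed

lemma const_plus_X_nth:
  "((fps_const a + fps_X) * W) $ 0 = a * (W $ 0 :: complex)"
  "((fps_const a + fps_X) * W) $ Suc n = a * W $ Suc n + W $ n"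
  by (simp_all add: ring_distribs)

text \<open>
In each coefficient the cross terms of \<open>|V\<^sub>n|\<^sup>2\<close> and \<open>|F\<^sub>n|\<^sup>2\<close> agree, and what remains is
\<open>(1 - |a|\<^sup>2)(|W\<^sub>n|\<^sup>2 - |W\<^sub>n\<^sub>-\<^sub>1|\<^sup>2)\<close>, which telescopes. This is the coefficient form of the fact that a
Blaschke factor has modulus 1 on the unit circle.
\<close>

lemma blaschke_energy:
  fixes a :: complex and W :: "complex fps"
  defines "F \<equiv> (fps_const a + fps_X) * W" and "V \<equiv> lin (cnj a) * W"
  shows "(\<Sum>n\<le>N. (cmod (V $ n))\<^sup>2) = (\<Sum>n\<le>N. (cmod (F $ n))\<^sup>2) + (1 - (cmod a)\<^sup>2) * (cmod (W $ N))\<^sup>2"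
proof (induction N)
  case 0
  show ?case
    by (simp add: F_def V_def const_plus_X_nth norm_mult power_mult_distrib algebra_simps)
next
  case (Suc N)
  have "(cmod (x + cnj a * y))\<^sup>2 + (1 - (cmod a)\<^sup>2) * (cmod y)\<^sup>2 =
      (cmod (a * x + y))\<^sup>2 + (1 - (cmod a)\<^sup>2) * (cmod x)\<^sup>2" for x y
    by (simp add: cmod_power2) algebra
  from this[of "W $ Suc N" "W $ N"] Suc show ?case
    by (simp add: F_def V_def const_plus_X_nth lin_mult_nth_Suc)
qed

lemma blaschke_contraction:
  assumes "cmod a < 1"
  shows "(\<Sum>n\<le>N. (cmod ((blaschke a * V) $ n))\<^sup>2) \<le> (\<Sum>n\<le>N. (cmod (V $ n))\<^sup>2)"
proof -
  obtain W where W: "lin (cnj a) * W = V" "(fps_const a + fps_X) * W = blaschke a * V"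
    by (rule blaschke_multE)
  have "(cmod a)\<^sup>2 \<le> 1" using assms by (simp add: power_le_one)
  hence "0 \<le> (1 - (cmod a)\<^sup>2) * (cmod (W $ N))\<^sup>2" by simp
  thus ?thesis using blaschke_energy[of a W N] unfolding W by linarith
qed

lemma blaschke_power_contraction:
  assumes "cmod a < 1"
  shows "(\<Sum>n\<le>N. (cmod ((blaschke a ^ m * V) $ n))\<^sup>2) \<le> (\<Sum>n\<le>N. (cmod (V $ n))\<^sup>2)"
proof (induction m)
  case (Suc m)
  show ?case
    using order_trans[OF blaschke_contraction[OF assms] Suc] by (simp add: mult.assoc)
qed simp

lemma sq_sum_leI:
  assumes "\<And>N. (\<Sum>n\<le>N. (cmod (V $ n))\<^sup>2) \<le> C"
  shows "sq_summable_fps V" "(\<Sum>n. (cmod (V $ n))\<^sup>2) \<le> C"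
proof -
  have le: "(\<Sum>n<N. (cmod (V $ n))\<^sup>2) \<le> C" for N
  proof -
    have "(\<Sum>n<N. (cmod (V $ n))\<^sup>2) \<le> (\<Sum>n\<le>N. (cmod (V $ n))\<^sup>2)"
      by (rule sum_mono2) auto
    thus ?thesis using assms[of N] by linarith
  qed
  show "sq_summable_fps V" by (rule summableI_nonneg_bounded[OF _ le]) simp
  thus "(\<Sum>n. (cmod (V $ n))\<^sup>2) \<le> C" by (rule suminf_le_const[OF _ le])
qed

text \<open>
The quotient by \<open>X + a\<close> exists formally whenever \<open>a \<noteq> 0\<close>; the root makes the quotient tend to 0.
\<close>

lemma linear_factor_at_root:
  assumes F: "sq_summable_fps F" and a: "cmod a < 1" and zero: "(\<lambda>n. F $ n * (- a) ^ n) sums 0"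
  obtains W where "F = (fps_const a + fps_X) * W" "fps_nth W \<longlonglongrightarrow> 0"
proof -
  (* This solves F $ Suc n = W $ n + a * W $ Suc n downwards from infinity, where errors are
     multiplied by a; the equation for n = 0 is the one that needs the root. *)
  define w where "w n = (\<Sum>k. F $ (Suc n + k) * (- a) ^ k)" for n
  have geo: "(\<lambda>k. cmod a ^ k) sums (1 / (1 - cmod a))" using a by (simp add: geometric_sums)
  have F0: "fps_nth F \<longlonglongrightarrow> 0" by (rule sq_summable_imp_tendsto_0[OF F])
  obtain C where C: "\<And>n. cmod (F $ n) \<le> C"
    using sq_summable_imp_bounded[OF F] by (auto simp: Bseq_def)
  have summ: "summable (\<lambda>k. cmod (F $ (n + k) * (- a) ^ k))" for n
  proof (rule summable_comparison_test')
    show "summable (\<lambda>k. C * cmod a ^ k)" using geo by (intro summable_mult) (rule sums_summable)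
    show "norm (cmod (F $ (n + k) * (- a) ^ k)) \<le> C * cmod a ^ k" for k
      using C by (simp add: norm_mult norm_power mult_right_mono)
  qed
  have w: "(\<lambda>k. F $ (Suc n + k) * (- a) ^ k) sums w n" for n
    unfolding w_def using summable_norm_cancel[OF summ] by (rule summable_sums)
  have rec: "(\<lambda>k. F $ (n + k) * (- a) ^ k) sums (F $ n - a * w n)" for n
  proof -
    have "(\<lambda>k. F $ (n + Suc k) * (- a) ^ Suc k) sums (- a * w n)"
      using sums_mult[OF w[of n], of "- a"] by (simp add: mult_ac)
    from sums_Suc[OF this] show ?thesis by simp
  qed
  have "F = (fps_const a + fps_X) * Abs_fps w"
  proof (rule fps_ext)
    fix n
    show "F $ n = ((fps_const a + fps_X) * Abs_fps w) $ n"
    proof (cases n)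
      case 0
      have "(\<lambda>k. F $ k * (- a) ^ k) sums (F $ 0 - a * w 0)" using rec[of 0] by simp
      hence "F $ 0 - a * w 0 = 0" using zero by (rule sums_unique2)
      thus ?thesis by (simp add: 0 const_plus_X_nth)
    next
      case (Suc m)
      have "w m = F $ Suc m - a * w (Suc m)" using rec[of "Suc m"] w[of m] sums_unique2 by blast
      thus ?thesis by (simp add: Suc const_plus_X_nth)
    qed
  qed
  moreover have "w \<longlonglongrightarrow> 0"
  proof (rule LIMSEQ_I)
    fix e :: real assume "e > 0"
    define d where "d = e / 2 * (1 - cmod a)"
    have "d > 0" using \<open>e > 0\<close> a by (simp add: d_def)
    then obtain M where M: "\<And>n. n \<ge> M \<Longrightarrow> cmod (F $ n) \<le> d"
      using LIMSEQ_D[OF F0] by (metis diff_zero less_imp_le)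
    have "norm (w n - 0) < e" if "n \<ge> M" for n
    proof -
      have "norm (w n) \<le> (\<Sum>k. d * cmod a ^ k)" unfolding w_def
      proof (rule norm_suminf_le)
        show "norm (F $ (Suc n + k) * (- a) ^ k) \<le> d * cmod a ^ k" for k
          using M[of "Suc n + k"] that by (simp add: norm_mult norm_power mult_right_mono)
        show "summable (\<lambda>k. d * cmod a ^ k)"
          using geo by (intro summable_mult) (rule sums_summable)
      qed
      also have "\<dots> = d * (1 / (1 - cmod a))"
        using sums_mult[OF geo, of d] by (simp add: sums_iff)
      also have "\<dots> = e / 2 * ((1 - cmod a) / (1 - cmod a))"
        by (simp only: d_def mult.assoc times_divide_eq_right mult_1_right)
      also have "(1 - cmod a) / (1 - cmod a) = 1" using a by simp
      also have "e / 2 * 1 < e" using \<open>e > 0\<close> by simp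
      finally show ?thesis by simp
    qed
    thus "\<exists>M. \<forall>n\<ge>M. norm (w n - 0) < e" by blast
  qed
  ultimately show ?thesis using that[of "Abs_fps w"] by (simp add: fps_nth_Abs_fps[abs_def])
qed

text \<open>
The boundary term of the energy identity disappears in the limit because the quotient tends to 0.
\<close>

lemma blaschke_factor_at_root:
  assumes F: "sq_summable_fps F" and a: "cmod a < 1" and zero: "(\<lambda>n. F $ n * (- a) ^ n) sums 0"
  obtains W V where "F = (fps_const a + fps_X) * W" "V = lin (cnj a) * W" "bounded_fps W"
    "sq_summable_fps V" "(\<Sum>n. (cmod (V $ n))\<^sup>2) \<le> (\<Sum>n. (cmod (F $ n))\<^sup>2)"
proof -
  obtain W where FW: "F = (fps_const a + fps_X) * W" and W: "fps_nth W \<longlonglongrightarrow> 0"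
    using linear_factor_at_root[OF assms] .
  define V where "V = lin (cnj a) * W"
  define S where "S = (\<Sum>n. (cmod (F $ n))\<^sup>2)"
  have "(\<lambda>N. S + (1 - (cmod a)\<^sup>2) * (cmod (W $ N))\<^sup>2) \<longlonglongrightarrow> S + (1 - (cmod a)\<^sup>2) * (cmod 0)\<^sup>2"
    by (intro tendsto_intros W)
  hence lim: "(\<lambda>N. S + (1 - (cmod a)\<^sup>2) * (cmod (W $ N))\<^sup>2) \<longlonglongrightarrow> S" by simp
  have "(\<Sum>n\<le>M. (cmod (V $ n))\<^sup>2) \<le> S" for M
  proof (rule LIMSEQ_le_const[OF lim], intro exI[of _ M] allI impI)
    fix N assume "N \<ge> M"
    hence "(\<Sum>n\<le>M. (cmod (V $ n))\<^sup>2) \<le> (\<Sum>n\<le>N. (cmod (V $ n))\<^sup>2)"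
      by (intro sum_mono2) auto
    also have "\<dots> = (\<Sum>n\<le>N. (cmod (F $ n))\<^sup>2) + (1 - (cmod a)\<^sup>2) * (cmod (W $ N))\<^sup>2"
      unfolding V_def FW by (rule blaschke_energy)
    also have "(\<Sum>n\<le>N. (cmod (F $ n))\<^sup>2) \<le> S"
      unfolding S_def by (rule sum_le_suminf[OF F]) auto
    finally show "(\<Sum>n\<le>M. (cmod (V $ n))\<^sup>2) \<le> S + (1 - (cmod a)\<^sup>2) * (cmod (W $ N))\<^sup>2" by simp
  qed
  from sq_sum_leI[OF this] show ?thesis
    using that[OF FW V_def] W by (auto simp: S_def intro: convergent_imp_Bseq convergentI)
qed

section \<open>Vanishing on lattice rectangles\<close>

lemma lattice_gf_add_unit:
  assumes z: "z \<in> \<Lambda>\<^sub>+" and u: "u \<in> {\<i>, - \<i>}"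
  shows "lin ((1 - u) / 2) * lattice_gf (z + u) = lin ((1 + u) / 2) * lattice_gf z"
proof (cases "u = \<i>")
  case True
  thus ?thesis using lattice_gf_add_ii[OF z] by (simp add: alpha_plus_def alpha_minus_def)
next
  case False
  hence "u = - \<i>" using u by simp
  thus ?thesis using lattice_gf_add_ii[OF add_ii_in_lattice(2)[OF z]]
    by (simp add: alpha_plus_def alpha_minus_def)
qed

lemma dseries_eqI: "z \<in> \<Lambda>\<^sub>+ \<Longrightarrow> (\<lambda>n. F $ n * lattice_gf z $ n) sums c \<Longrightarrow> dseries F z = c"
  by (simp add: dseries_def dpow_eq sums_iff)

text \<open>
Let \<open>w\<close> and \<open>w'\<close> be the functions with series \<open>W\<close> and \<open>X W\<close>. The edge recurrence of the generating functions gives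
\<open>w'(z + u) + a w(z + u) = w'(z) + a\<^sup>* w(z)\<close>. The left-hand side is the value at \<open>z + u\<close> of the
function with series \<open>F\<close>, and the right-hand side is a combination of the values at \<open>z\<close> of the functions
with series \<open>V\<close> and \<open>F\<close>, because \<open>w(z)\<close> and \<open>w'(z)\<close>
can be recovered from these two.
\<close>

lemma dseries_unit_step:
  assumes W: "bounded_fps W" and z: "z \<in> \<Lambda>\<^sub>+" and u: "u \<in> {\<i>, - \<i>}" and a: "a = (1 - u) / 2"
  defines "F \<equiv> (fps_const a + fps_X) * W" and "V \<equiv> lin (cnj a) * W"
  shows "dseries F (z + u) = 2 * u * dseries V z + (2 - u) * dseries F z"
proof -
  have u2: "u * u = -1" using u by auto
  have ca: "cnj a = (1 + u) / 2" unfolding a using u by auto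
  have zu: "z + u \<in> \<Lambda>\<^sub>+" using add_ii_in_lattice[OF z] u by auto
  (* The values at y of the functions with series W and fps_X * W. *)
  define P where "P y = (\<Sum>n. W $ n * lattice_gf y $ n)" for y
  define Q where "Q y = (\<Sum>n. W $ n * lattice_gf y $ Suc n)" for y
  have P: "(\<lambda>n. W $ n * lattice_gf y $ n) sums P y" for y
    unfolding P_def
    by (intro summable_sums summable_norm_cancel[OF abs_summable_bounded_times]
        W abs_summable_lattice_gf)
  have Q: "(\<lambda>n. W $ n * lattice_gf y $ Suc n) sums Q y" for y
  proof -
    have "abs_summable_fps (fps_shift 1 (lattice_gf y))"
      using abs_summable_lattice_gf[of y] by (simp add: summable_Suc_iff[of "\<lambda>n. cmod (lattice_gf y $ n)"])
    from summable_sums[OF summable_norm_cancel[OF abs_summable_bounded_times[OF W this]]]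
    show ?thesis by (simp add: Q_def)
  qed
  have X: "(\<lambda>n. (fps_X * W) $ n * lattice_gf y $ n) sums Q y" for y
  proof -
    have "(\<lambda>n. (fps_X * W) $ Suc n * lattice_gf y $ Suc n) sums Q y" using Q[of y] by simp
    from sums_Suc[OF this] show ?thesis by simp
  qed
  have F: "dseries F y = a * P y + Q y" if "y \<in> \<Lambda>\<^sub>+" for y
    using that
  proof (rule dseries_eqI)
    show "(\<lambda>n. F $ n * lattice_gf y $ n) sums (a * P y + Q y)"
      using sums_add[OF sums_mult[OF P[of y], of a] X[of y]]
      by (simp add: F_def ring_distribs mult.assoc)
  qed
  have V: "dseries V y = P y + cnj a * Q y" if "y \<in> \<Lambda>\<^sub>+" for y
    using that
  proof (rule dseries_eqI)
    show "(\<lambda>n. V $ n * lattice_gf y $ n) sums (P y + cnj a * Q y)"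
      using sums_add[OF P[of y] sums_mult[OF X[of y], of "cnj a"]]
      by (simp add: V_def lin_def ring_distribs mult.assoc)
  qed
  have "Q (z + u) + a * P (z + u) = Q z + cnj a * P z"
  proof (rule sums_unique2)
    show "(\<lambda>n. W $ n * lattice_gf (z + u) $ Suc n + a * (W $ n * lattice_gf (z + u) $ n))
        sums (Q (z + u) + a * P (z + u))"
      by (intro sums_add sums_mult P Q)
    have "lattice_gf (z + u) $ Suc n + a * lattice_gf (z + u) $ n =
        lattice_gf z $ Suc n + cnj a * lattice_gf z $ n" for n
      using arg_cong[OF lattice_gf_add_unit[OF z u], of "\<lambda>G. G $ Suc n"]
      unfolding a[symmetric] ca[symmetric] by (simp only: lin_mult_nth_Suc)
    hence "W $ n * (lattice_gf (z + u) $ Suc n + a * lattice_gf (z + u) $ n) =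
        W $ n * (lattice_gf z $ Suc n + cnj a * lattice_gf z $ n)" for n
      by (simp only:)
    hence "W $ n * lattice_gf (z + u) $ Suc n + a * (W $ n * lattice_gf (z + u) $ n) =
        W $ n * lattice_gf z $ Suc n + cnj a * (W $ n * lattice_gf z $ n)" for n
      by (simp add: ring_distribs mult_ac)
    moreover have "(\<lambda>n. W $ n * lattice_gf z $ Suc n + cnj a * (W $ n * lattice_gf z $ n))
        sums (Q z + cnj a * P z)"
      by (intro sums_add sums_mult P Q)
    ultimately show "(\<lambda>n. W $ n * lattice_gf (z + u) $ Suc n + a * (W $ n * lattice_gf (z + u) $ n))
        sums (Q z + cnj a * P z)"
      by simp
  qed
  hence "dseries F (z + u) = Q z + (1 + u) / 2 * P z" 
    by (simp only: F[OF zu] ca add.commute[of "a * P (z + u)"])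
  also have "\<dots> = 2 * u * (P z + (1 + u) / 2 * Q z) + (2 - u) * ((1 - u) / 2 * P z + Q z)"
  proof -
    have "2 * u * (P z + (1 + u) / 2 * Q z) + (2 - u) * ((1 - u) / 2 * P z + Q z) =
        Q z + (1 + u) / 2 * P z + (u * u + 1) * (Q z + P z / 2)"
      by (simp add: field_simps)
    thus ?thesis by (simp add: u2)
  qed
  finally show ?thesis unfolding F[OF z] V[OF z] ca unfolding a .
qed

lemma dseries_row_zero_iff:
  "(\<forall>j\<le>x. dseries F (of_nat j) = 0) \<longleftrightarrow> (\<forall>n\<le>x. F $ n = 0)"
proof
  have fin: "dseries F (of_nat j) = (\<Sum>n\<le>j. F $ n * of_nat (j choose n))" for j
  proof (rule dseries_eqI[OF of_nat_in_lattice])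
    show "(\<lambda>n. F $ n * lattice_gf (of_nat j) $ n) sums (\<Sum>n\<le>j. F $ n * of_nat (j choose n))"
      unfolding dpow_of_nat[symmetric] dpow_eq[OF of_nat_in_lattice, symmetric]
      by (rule sums_finite) (auto simp: dpow_of_nat)
  qed
  show "\<forall>n\<le>x. F $ n = 0" if *: "\<forall>j\<le>x. dseries F (of_nat j) = 0"
  proof (intro allI impI)
    fix n assume "n \<le> x"
    thus "F $ n = 0"
    proof (induction n rule: less_induct)
      case (less n)
      have "(\<Sum>k<n. F $ k * of_nat (n choose k)) = 0" using less by (intro sum.neutral) auto
      moreover have "dseries F (of_nat n) = 0" using * less.prems by simp
      ultimately show ?case by (simp add: fin flip: lessThan_Suc_atMost)
    qed
  qed
  show "\<forall>j\<le>x. dseries F (of_nat j) = 0" if "\<forall>n\<le>x. F $ n = 0"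
    using that by (auto simp: fin intro!: sum.neutral)
qed

lemma node_in_lattice: "u \<in> {\<i>, - \<i>} \<Longrightarrow> of_nat j + of_nat k * u \<in> \<Lambda>\<^sub>+"
  by (auto simp: lattice_plus_def)

lemma cmod_unit_parameter: "u \<in> {\<i>, - \<i>} \<Longrightarrow> cmod ((1 - u) / 2) < 1"
  using cmod_alpha by (auto simp: alpha_plus_def alpha_minus_def)

text \<open>
The generating function at \<open>u\<close> is a constant plus a multiple of \<open>1 / (1 + a X)\<close>, the kernel of evaluation
at \<open>- a\<close>; the values at \<open>0\<close> and \<open>u\<close> together determine the value of \<open>F\<close> at \<open>- a\<close>.
\<close>

lemma root_of_vanishing:
  assumes F: "bounded_fps F" and u: "u \<in> {\<i>, - \<i>}" and a: "a = (1 - u) / 2"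
    and "dseries F 0 = 0" "dseries F u = 0"
  shows "(\<lambda>n. F $ n * (- a) ^ n) sums 0"
proof -
  have "F $ 0 = 0" using dseries_row_zero_iff[of 0 F] assms(4) by simp
  have u': "u \<in> \<Lambda>\<^sub>+" using u by (auto simp: lattice_plus_def)
  have "lin ((1 - u) / 2) * lattice_gf u = lin ((1 + u) / 2)"
    using lattice_gf_add_unit[OF zero_in_lattice u] by (simp add: lattice_gf_0)
  hence "lattice_gf u = lin ((1 + u) / 2) * inverse (lin a)"
    unfolding a by (rule lin_divide)
  hence gf: "lattice_gf u $ Suc n = u * (- a) ^ n" for n
    by (simp add: lin_mult_nth_Suc inverse_lin_nth a diff_divide_distrib add_divide_distrib algebra_simps)
  have "u \<noteq> 0" using u by auto
  (* For n = 0 both sides vanish with F $ 0; for n > 0 the powers of - a are a fixed multiple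
     of the coefficients of the generating function at u. *)
  have eq: "(- a / u) * (F $ n * lattice_gf u $ n) = F $ n * (- a) ^ n" for n
    using \<open>F $ 0 = 0\<close> \<open>u \<noteq> 0\<close> by (cases n) (simp_all add: gf)
  show ?thesis
    using sums_mult[OF dseries_sums[OF F u'], of "- a / u"] assms(5) unfolding eq by simp
qed

text \<open>
Each row of the rectangle above the real axis splits off one Blaschke factor, by the step relation; what is left
vanishes on the row on the real axis and is divisible by a power of \<open>X\<close>.
\<close>

lemma vanishing_factorization:
  assumes u: "u \<in> {\<i>, - \<i>}" and a: "a = (1 - u) / 2"
    and F: "sq_summable_fps F"
    and "\<And>j k. j \<le> x \<Longrightarrow> k \<le> m \<Longrightarrow> dseries F (of_nat j + of_nat k * u) = 0"
  shows "\<exists>V. F = fps_X ^ Suc x * blaschke a ^ m * V \<and> sq_summable_fps V \<and>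
      (\<Sum>n. (cmod (V $ n))\<^sup>2) \<le> (\<Sum>n. (cmod (F $ n))\<^sup>2)"
  using F assms(4)
proof (induction m arbitrary: F)
  case 0
  hence "\<forall>j\<le>x. dseries F (of_nat j) = 0" by simp
  hence zero: "F $ n = 0" if "n < Suc x" for n using that by (simp add: dseries_row_zero_iff)
  define V where "V = fps_shift (Suc x) F"
  have "F = fps_X ^ Suc x * V"
    by (rule fps_ext) (auto simp: V_def fps_X_power_mult_nth zero simp del: power_Suc)
  moreover have "sq_summable_fps V"
    unfolding V_def using summable_ignore_initial_segment[OF 0(1), of "Suc x"] by simp
  moreover have "(\<Sum>n. (cmod (V $ n))\<^sup>2) \<le> (\<Sum>n. (cmod (F $ n))\<^sup>2)"
    using suminf_minus_initial_segment[OF 0(1), of "Suc x"] 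
      sum_nonneg[of "{..<Suc x}" "\<lambda>n. (cmod (F $ n))\<^sup>2"]
    by (simp add: V_def del: sum.lessThan_Suc)
  ultimately show ?case by (intro exI[of _ V]) simp
next
  case (Suc m)
  have "dseries F 0 = 0" "dseries F u = 0" using Suc.prems(2)[of 0 0] Suc.prems(2)[of 0 1] by simp_all
  hence "(\<lambda>n. F $ n * (- a) ^ n) sums 0"
    by (rule root_of_vanishing[OF sq_summable_imp_bounded[OF Suc.prems(1)] u a])
  from blaschke_factor_at_root[OF Suc.prems(1) _ this] obtain W V where
    W: "F = (fps_const a + fps_X) * W" "V = lin (cnj a) * W" "bounded_fps W"
    and V: "sq_summable_fps V" "(\<Sum>n. (cmod (V $ n))\<^sup>2) \<le> (\<Sum>n. (cmod (F $ n))\<^sup>2)"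
    using cmod_unit_parameter[OF u] unfolding a by blast
  have "dseries V (of_nat j + of_nat k * u) = 0" if "j \<le> x" "k \<le> m" for j k
  proof -
    have "dseries F (of_nat j + of_nat k * u + u) = 0"
      using Suc.prems(2)[of j "Suc k"] that by (simp add: algebra_simps)
    moreover have "dseries F (of_nat j + of_nat k * u) = 0" using Suc.prems(2)[of j k] that by simp
    ultimately have "2 * u * dseries V (of_nat j + of_nat k * u) = 0"
      using dseries_unit_step[OF W(3) node_in_lattice[OF u, of j k] u a] W(1,2) by simp
    thus ?thesis using u by auto
  qed
  from Suc.IH[OF V(1) this] obtain V' where
    V': "V = fps_X ^ Suc x * blaschke a ^ m * V'" "sq_summable_fps V'"
    "(\<Sum>n. (cmod (V' $ n))\<^sup>2) \<le> (\<Sum>n. (cmod (V $ n))\<^sup>2)" by blast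
  have "F = blaschke a * V" unfolding W(1,2) by (rule blaschke_mult_lin[symmetric])
  also have "\<dots> = fps_X ^ Suc x * blaschke a ^ Suc m * V'"
    unfolding V'(1) power_Suc[of "blaschke a"] by (simp only: mult_ac)
  finally show ?case using V'(2) order_trans[OF V'(3) V(2)] by blast
qed

text \<open>
The step relation propagates zeros upwards: the value at height \<open>i + 1\<close> is a combination of the values
at height \<open>i\<close> of the product itself and of the product with one factor less.
\<close>

lemma blaschke_product_vanishes:
  assumes u: "u \<in> {\<i>, - \<i>}" and a: "a = (1 - u) / 2" and "j \<le> x" "k \<le> m"
  shows "dseries (fps_X ^ Suc x * blaschke a ^ m) (of_nat j + of_nat k * u) = 0"
  using \<open>k \<le> m\<close>
proof (induction m arbitrary: k)
  case 0
  have "dseries (fps_X ^ Suc x) (of_nat j) = 0"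
    using dseries_row_zero_iff[of x "fps_X ^ Suc x"] \<open>j \<le> x\<close>
    by (auto simp: fps_X_power_nth simp del: power_Suc)
  thus ?case using 0 by simp
next
  case (Suc m)
  have a1: "cmod a < 1" using cmod_unit_parameter[OF u] by (simp only: a)
  define V where "V = fps_X ^ Suc x * blaschke a ^ m"
  define F where "F = fps_X ^ Suc x * blaschke a ^ Suc m"
  define W where "W = inverse (lin (cnj a)) * V"
  have "abs_summable_fps W" unfolding W_def V_def using a1
    by (intro abs_summable_fps_mult abs_summable_fps_inverse_lin abs_summable_fps_X_power
        abs_summable_fps_power abs_summable_blaschke) simp_all
  hence W: "bounded_fps W" by (rule abs_summable_imp_bounded)
  have V: "V = lin (cnj a) * W"
    by (simp only: W_def mult.assoc[symmetric] lin_inverse mult_1_left)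
  have F: "F = (fps_const a + fps_X) * W"
    unfolding blaschke_mult_lin[symmetric] V[symmetric]
    by (simp only: F_def V_def power_Suc[of "blaschke a"] mult_ac)
  have IH: "dseries V (of_nat j + of_nat i * u) = 0" if "i \<le> m" for i
    unfolding V_def using that by (rule Suc.IH)
  have "dseries F (of_nat j + of_nat i * u) = 0" if "i \<le> Suc m" for i
    using that
  proof (induction i)
    case 0
    have "dseries F (of_nat j) = 0"
      using dseries_row_zero_iff[of x F] \<open>j \<le> x\<close>
      by (auto simp: F_def fps_X_power_mult_nth simp del: power_Suc)
    thus ?case by simp
  next
    case (Suc i)
    have "dseries F (of_nat j + of_nat i * u + u) = 0"
      using dseries_unit_step[OF W node_in_lattice[OF u, of j i] u a, folded F V] IH[of i] Suc
      by simp
    thus ?case by (simp add: algebra_simps)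
  qed
  thus ?case using Suc.prems by (simp only: F_def)
qed

section \<open>Blaschke functions and rectangles in terms of series\<close>

lemma dseries_extensional: "dseries F \<in> extensional \<Lambda>\<^sub>+"
  by (simp add: dseries_def)

lemma dseries_scale:
  assumes "bounded_fps F"
  shows "dseries (fps_const c * F) = (\<lambda>z\<in>\<Lambda>\<^sub>+. c * dseries F z)"
proof -
  have "dseries (fps_const c * F) z = c * dseries F z" if z: "z \<in> \<Lambda>\<^sub>+" for z
    using sums_mult[OF dseries_sums[OF assms z], of c]
    by (intro dseries_eqI[OF z]) (simp add: mult.assoc)
  thus ?thesis by (auto simp: dseries_def restrict_def)
qed

lemma dseries_const: "z \<in> \<Lambda>\<^sub>+ \<Longrightarrow> dseries (fps_const c) z = c"
  using sums_finite[of "{0}" "\<lambda>n. fps_const c $ n * lattice_gf z $ n"]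
  by (intro dseries_eqI) (simp_all add: lattice_gf_nth_0)

lemma dseries_add:
  assumes "bounded_fps F" "bounded_fps G" "z \<in> \<Lambda>\<^sub>+"
  shows "dseries (F + G) z = dseries F z + dseries G z"
  using sums_add[OF dseries_sums[OF assms(1,3)] dseries_sums[OF assms(2,3)]]
  by (intro dseries_eqI[OF assms(3)]) (simp add: ring_distribs)

lemma identity_eq_dseries: "(\<lambda>z\<in>\<Lambda>\<^sub>+. z) = dseries fps_X"
proof -
  have int: "discrete_integral 0 z one_plus = z - 0" if "z \<in> \<Lambda>\<^sub>+" for z
    using that by (rule discrete_integral_primitive[rotated]) (simp add: one_plus_def)
  have "dpow 1 = (\<lambda>z\<in>\<Lambda>\<^sub>+. z)"
    unfolding dpow_def One_nat_def funpow.simps o_apply id_apply Zop_def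
    by (intro restrict_ext) (simp add: int, simp add: one_plus_def zero_in_lattice)
  thus ?thesis using dpow_eq_dseries[of 1] by simp
qed

lemma geom_inv_eq_dseries: "geom_inv (- a) = dseries (inverse (lin a))"
  by (simp add: geom_inv_def dseries_def inverse_lin_nth)

text \<open>
Both Blaschke functions have this shape, the one with sign plus for \<open>a = \<alpha>\<^sub>-\<close> and the one with sign
minus for \<open>a = \<alpha>\<^sub>+\<close>, since the two parameters are conjugate to each other.
\<close>

lemma blaschke_function_eq_dseries:
  assumes "cmod a < 1"
  shows "(\<lambda>z\<in>\<Lambda>\<^sub>+. a + cnj a * ((\<lambda>u\<in>\<Lambda>\<^sub>+. u) \<odot> geom_inv (- cnj a)) z * a) =
      dseries (fps_const a + fps_const (cnj a * a) * (fps_X * inverse (lin (cnj a))))"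
    (is "_ = dseries (_ + _ * ?H)")
proof -
  have inv: "abs_summable_fps (inverse (lin (cnj a)))"
    using assms by (intro abs_summable_fps_inverse_lin) simp
  have X: "abs_summable_fps fps_X" using abs_summable_fps_X_power[of 1] by simp
  have H: "bounded_fps ?H"
    by (intro abs_summable_imp_bounded abs_summable_fps_mult inv X)
  have bd: "bounded_fps (fps_const a)" "bounded_fps (fps_const (cnj a * a) * ?H)"
    by (intro abs_summable_imp_bounded abs_summable_fps_mult inv X abs_summable_fps_finite[of 0];
        simp)+
  have sum: "dseries (fps_const a + fps_const (cnj a * a) * ?H) z =
      a + cnj a * dseries ?H z * a" if "z \<in> \<Lambda>\<^sub>+" for z
  proof -
    have "dseries (fps_const a + fps_const (cnj a * a) * ?H) z =
        dseries (fps_const a) z + dseries (fps_const (cnj a * a) * ?H) z"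
      using bd that by (rule dseries_add)
    also have "\<dots> = a + cnj a * a * dseries ?H z"
      by (simp only: dseries_const[OF that] dseries_scale[OF H] restrict_apply that if_True)
    finally show ?thesis by (simp only: mult_ac)
  qed
  have "(\<lambda>u\<in>\<Lambda>\<^sub>+. u) \<odot> geom_inv (- cnj a) = dseries ?H"
    unfolding identity_eq_dseries geom_inv_eq_dseries
    using inv X by (intro dconv_dseries abs_summable_imp_bounded)
  hence "(\<lambda>z\<in>\<Lambda>\<^sub>+. a + cnj a * ((\<lambda>u\<in>\<Lambda>\<^sub>+. u) \<odot> geom_inv (- cnj a)) z * a) =
      (\<lambda>z\<in>\<Lambda>\<^sub>+. dseries (fps_const a + fps_const (cnj a * a) * ?H) z)"
    by (intro restrict_ext) (simp only: sum)
  thus ?thesis by (simp only: extensional_restrict[OF dseries_extensional])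
qed

lemma Blaschke_eq_dseries:
  assumes u: "u \<in> {\<i>, - \<i>}" and a: "a = (1 - u) / 2"
  shows "(if u = \<i> then Blaschke_plus else Blaschke_minus) = dseries (blaschke a)"
proof -
  have ca: "cnj a = (1 + u) / 2" unfolding a using u by auto
  have half: "cnj a * a + a * cnj a = 1" using u unfolding ca a by (auto simp: field_simps)
  have "lin (cnj a) * (fps_const a + fps_const (cnj a * a) * (fps_X * inverse (lin (cnj a)))) =
      fps_const a * lin (cnj a) + fps_const (cnj a * a) * fps_X * (lin (cnj a) * inverse (lin (cnj a)))"
    by (simp only: ring_distribs mult_ac)
  also have "\<dots> = fps_const a + fps_const (a * cnj a + cnj a * a) * fps_X"
    unfolding lin_inverse
    by (simp only: lin_def ring_distribs mult_1_right mult.assoc add.assoc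
        fps_const_add[symmetric] fps_const_mult[symmetric])
  also have "\<dots> = fps_const a + fps_X" using half by (simp add: add.commute)
  finally have "fps_const a + fps_const (cnj a * a) * (fps_X * inverse (lin (cnj a))) = blaschke a"
    unfolding blaschke_def by (rule lin_divide)
  moreover have "(if u = \<i> then Blaschke_plus else Blaschke_minus) =
      (\<lambda>z\<in>\<Lambda>\<^sub>+. a + cnj a * ((\<lambda>u\<in>\<Lambda>\<^sub>+. u) \<odot> geom_inv (- cnj a)) z * a)"
  proof (cases "u = \<i>")
    case True
    hence "alpha_minus = a" "alpha_plus = cnj a"
      by (simp_all add: ca) (simp_all add: a alpha_plus_def alpha_minus_def)
    thus ?thesis using True by (simp only: Blaschke_plus_def simp_thms if_True)
  next
    case False
    hence "u = - \<i>" using u by simp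
    hence "alpha_plus = a" "alpha_minus = cnj a"
      by (simp_all add: ca) (simp_all add: a alpha_plus_def alpha_minus_def)
    thus ?thesis using False by (simp only: Blaschke_minus_def if_False)
  qed
  ultimately show ?thesis
    using blaschke_function_eq_dseries[of a] cmod_unit_parameter[OF u] by (simp only: a)
qed

lemma rect_eq:
  assumes l: "l \<in> \<Lambda>\<^sub>+" and u: "u = (if Im l \<ge> 0 then \<i> else - \<i>)"
  shows "rect l = {of_nat j + of_nat k * u | j k. j \<le> nat \<lfloor>Re l\<rfloor> \<and> k \<le> nat \<lfloor>\<bar>Im l\<bar>\<rfloor>}"
proof -
  obtain a y where l': "l = Complex (real a) (of_int y)" by (rule lattice_plusE[OF l])
  have uy: "u = (if y \<ge> 0 then \<i> else - \<i>)" using u by (simp add: l')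
  have fl: "nat \<lfloor>Re l\<rfloor> = a" "nat \<lfloor>\<bar>Im l\<bar>\<rfloor> = nat \<bar>y\<bar>"
    by (simp_all add: l' flip: of_int_abs)
  show ?thesis
  proof (intro equalityI subsetI)
    fix z assume z: "z \<in> rect l"
    hence "z \<in> \<Lambda>\<^sub>+" by (simp add: rect_def)
    then obtain b v where z': "z = Complex (real b) (of_int v)" by (rule lattice_plusE)
    have "real b \<le> real a" "\<bar>real_of_int v\<bar> \<le> \<bar>real_of_int y\<bar>" "real_of_int v * real_of_int y \<ge> 0"
      using z by (simp_all add: rect_def l' z')
    hence "b \<le> a" and vy: "\<bar>v\<bar> \<le> \<bar>y\<bar>" and "v * y \<ge> 0"
      by (simp_all flip: of_int_abs of_int_mult)
    hence "v = (if y \<ge> 0 then \<bar>v\<bar> else - \<bar>v\<bar>)"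
      by (auto simp: zero_le_mult_iff split: if_splits)
    hence "z = of_nat b + of_nat (nat \<bar>v\<bar>) * u"
      by (simp add: z' uy complex_eq_iff split: if_splits)
    moreover have "nat \<bar>v\<bar> \<le> nat \<bar>y\<bar>" using vy by simp
    ultimately show "z \<in> {of_nat j + of_nat k * u | j k. j \<le> nat \<lfloor>Re l\<rfloor> \<and> k \<le> nat \<lfloor>\<bar>Im l\<bar>\<rfloor>}"
      unfolding fl using \<open>b \<le> a\<close> by blast
  next
    fix z assume "z \<in> {of_nat j + of_nat k * u | j k. j \<le> nat \<lfloor>Re l\<rfloor> \<and> k \<le> nat \<lfloor>\<bar>Im l\<bar>\<rfloor>}"
    then obtain j k where z: "z = of_nat j + of_nat k * u" and jk: "j \<le> a" "k \<le> nat \<bar>y\<bar>"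
      unfolding fl by blast
    have "u \<in> {\<i>, - \<i>}" using uy by simp
    hence "z \<in> \<Lambda>\<^sub>+" unfolding z by (rule node_in_lattice)
    moreover have "real k \<le> \<bar>real_of_int y\<bar>" using jk by linarith
    ultimately show "z \<in> rect l" using jk
      by (auto simp: rect_def l' z uy zero_le_mult_iff)
  qed
qed

section \<open>Uniqueness of the generator\<close>

text \<open>
The constant terms have product 1 and modulus at most 1, hence modulus exactly 1; the norm leaves no room
for further coefficients.
\<close>

lemma inverse_pair_constant:
  fixes U V :: "complex fps"
  assumes "U * V = 1"
    and U: "sq_summable_fps U" "(\<Sum>n. (cmod (U $ n))\<^sup>2) \<le> 1"
    and V: "sq_summable_fps V" "(\<Sum>n. (cmod (V $ n))\<^sup>2) \<le> 1"
  obtains c where "cmod c = 1" "V = fps_const c"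
proof -
  have partial: "(\<Sum>n\<in>A. (cmod (F $ n))\<^sup>2) \<le> 1"
    if "sq_summable_fps F" "(\<Sum>n. (cmod (F $ n))\<^sup>2) \<le> 1" "finite A" for F :: "complex fps" and A
    using sum_le_suminf[OF that(1,3)] that(2) by force
  have "cmod (U $ 0) * cmod (V $ 0) = 1"
    using arg_cong[OF assms(1), of "\<lambda>F. cmod (F $ 0)"] by (simp add: norm_mult)
  moreover have le: "cmod (U $ 0) \<le> 1" "cmod (V $ 0) \<le> 1"
    using partial[OF U, of "{0}"] partial[OF V, of "{0}"] by (simp_all add: power_le_one_iff)
  moreover have "cmod (U $ 0) * cmod (V $ 0) \<le> 1 * cmod (V $ 0)"
    using le by (intro mult_right_mono) auto
  ultimately have V0: "cmod (V $ 0) = 1" by linarith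
  have "V $ n = 0" if "n > 0" for n
    using partial[OF V, of "{0, n}"] that V0 by simp
  hence "V = fps_const (V $ 0)" by (simp add: fps_eq_iff)
  thus ?thesis using that V0 by blast
qed

theorem theorem6p3:
  fixes l :: complex and B :: "complex \<Rightarrow> complex"
  assumes "l \<in> \<Lambda>\<^sub>+"
    and "Schur_function B"
    and "isometry_on_Hardy (\<lambda>f. B \<odot> f)"
    and "(\<lambda>f. B \<odot> f) ` Hardy = {f \<in> Hardy. \<forall>z\<in>rect l. f z = 0}"
  shows "\<exists>c. cmod c = 1 \<and>
    B = (\<lambda>z\<in>\<Lambda>\<^sub>+. c * (dpow (nat \<lfloor>Re l\<rfloor> + 1) \<odot>
           dconv_power (if Im l \<ge> 0 then Blaschke_plus else Blaschke_minus) (nat \<lfloor>\<bar>Im l\<bar>\<rfloor>)) z)"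
proof -
  define x where "x = nat \<lfloor>Re l\<rfloor>"
  define m where "m = nat \<lfloor>\<bar>Im l\<bar>\<rfloor>"
  (* The vertical direction of the rectangle; - a is the zero of the Blaschke factor. *)
  define u where "u = (if Im l \<ge> 0 then \<i> else - \<i>)"
  define a where "a = (1 - u) / 2"
  have u: "u \<in> {\<i>, - \<i>}" by (simp add: u_def)
  have a1: "cmod a < 1" using cmod_unit_parameter[OF u] by (simp add: a_def)
  have rect: "rect l = {of_nat j + of_nat k * u | j k. j \<le> x \<and> k \<le> m}"
    using rect_eq[OF assms(1) u_def] by (simp only: x_def m_def)
  define g where "g = fps_X ^ Suc x * blaschke a ^ m"
  have blaschke_m: "abs_summable_fps (blaschke a ^ m)"
    by (intro abs_summable_fps_power abs_summable_blaschke a1)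
  have g_abs: "abs_summable_fps g"
    unfolding g_def by (intro abs_summable_fps_mult abs_summable_fps_X_power blaschke_m)
  have candidate: "dpow (nat \<lfloor>Re l\<rfloor> + 1) \<odot>
      dconv_power (if Im l \<ge> 0 then Blaschke_plus else Blaschke_minus) (nat \<lfloor>\<bar>Im l\<bar>\<rfloor>) = dseries g"
  proof -
    have "(if Im l \<ge> 0 then Blaschke_plus else Blaschke_minus) =
        (if u = \<i> then Blaschke_plus else Blaschke_minus)"
      by (simp add: u_def complex_eq_iff)
    also have "\<dots> = dseries (blaschke a)" by (rule Blaschke_eq_dseries[OF u a_def])
    moreover have "dseries (fps_X ^ Suc x) \<odot> dseries (blaschke a ^ m) = dseries g"
      unfolding g_def
      by (intro dconv_dseries abs_summable_imp_bounded abs_summable_fps_X_power blaschke_m)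
    ultimately show ?thesis
      unfolding x_def[symmetric] m_def[symmetric]
      by (simp add: dpow_eq_dseries dconv_power_dseries abs_summable_blaschke a1 del: power_Suc)
  qed
  have "(\<Sum>n\<le>N. (cmod (g $ n))\<^sup>2) \<le> 1" for N
  proof -
    have "(\<Sum>n\<le>N. (cmod (g $ n))\<^sup>2) \<le> (\<Sum>n\<le>N. (cmod ((fps_X ^ Suc x :: complex fps) $ n))\<^sup>2)"
      using blaschke_power_contraction[OF a1, of m "fps_X ^ Suc x" N]
      by (simp only: g_def mult.commute)
    also have "\<dots> \<le> 1"
      by (simp add: fps_X_power_nth if_distrib[of "\<lambda>t. (cmod t)\<^sup>2"] cong: if_cong del: power_Suc)
    finally show ?thesis .
  qed
  from sq_sum_leI[OF this] have g: "sq_summable_fps g" "(\<Sum>n. (cmod (g $ n))\<^sup>2) \<le> 1" by auto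
  have iso: "dseries (b * F) \<in> Hardy \<and> (\<Sum>n. (cmod ((b * F) $ n))\<^sup>2) = (\<Sum>n. (cmod (F $ n))\<^sup>2)"
    if "sq_summable_fps F" "B = dseries b" "bounded_fps b" for F b
  proof -
    have conv: "B \<odot> dseries F = dseries (b * F)"
      using that sq_summable_imp_bounded by (simp add: dconv_dseries)
    have "dseries F \<in> Hardy" using that(1) by (simp add: dseries_in_Hardy_iff)
    hence *: "dseries (b * F) \<in> Hardy" "Hardy_norm (dseries (b * F)) = Hardy_norm (dseries F)"
      using assms(3) conv by (auto simp: isometry_on_Hardy_def)
    thus ?thesis using that(1) by (simp add: dseries_in_Hardy_iff Hardy_norm_dseries)
  qed
  obtain b where b_bd: "bounded_fps b" and B: "B = dseries b"
    using Schur_function_expansion[OF assms(2)] by blast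
  have one: "sq_summable_fps 1" "(\<Sum>n. (cmod ((1 :: complex fps) $ n))\<^sup>2) = 1"
    using abs_summable_imp_sq_summable[OF abs_summable_fps_1]
      sums_finite[of "{0}" "\<lambda>n. (cmod ((1 :: complex fps) $ n))\<^sup>2"] by (simp_all add: sums_iff)
  have b: "sq_summable_fps b" "(\<Sum>n. (cmod (b $ n))\<^sup>2) = 1"
    using iso[OF one(1) B b_bd] one(2) by (simp_all add: dseries_in_Hardy_iff)
  (* B is the image of the constant 1, so it has norm 1 and vanishes on the rectangle. *)
  have "B \<in> (\<lambda>f. B \<odot> f) ` Hardy"
  proof
    show "B = B \<odot> dseries 1"
      using sq_summable_imp_bounded[OF one(1)] b_bd by (simp add: B dconv_dseries)
    show "dseries 1 \<in> Hardy" using one(1) by (simp add: dseries_in_Hardy_iff)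
  qed
  hence "dseries b (of_nat j + of_nat k * u) = 0" if "j \<le> x" "k \<le> m" for j k
    using assms(4) that by (auto simp: B rect)
  from vanishing_factorization[OF u a_def b(1) this] obtain V where
    V: "b = g * V" "sq_summable_fps V" "(\<Sum>n. (cmod (V $ n))\<^sup>2) \<le> 1"
    by (auto simp: g_def b(2))
  have "dseries g \<in> {f \<in> Hardy. \<forall>z\<in>rect l. f z = 0}"
    using blaschke_product_vanishes[OF u a_def] g(1) by (auto simp: rect g_def dseries_in_Hardy_iff)
  then obtain f where f: "f \<in> Hardy" "dseries g = B \<odot> f" using assms(4) by blast
  obtain U where U: "sq_summable_fps U" "f = dseries U" using HardyE[OF f(1)] .
  have "has_expansion (dseries g) (fps_nth (b * U))"
  proof -
    have "dseries (b * U) \<in> Hardy" using iso[OF U(1) B b_bd] by blast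
    hence "has_expansion (dseries (b * U)) (fps_nth (b * U))"
      by (intro has_expansion_dseries sq_summable_imp_bounded) (simp add: dseries_in_Hardy_iff)
    moreover have "dseries g = dseries (b * U)"
      using f(2) b_bd sq_summable_imp_bounded[OF U(1)] by (simp add: U(2) B dconv_dseries)
    ultimately show ?thesis by simp
  qed
  hence "fps_nth (b * U) = fps_nth g" by (rule has_expansion_unique)
  hence bU: "b * U = g" by (simp only: fps_nth_inject)
  have "g * (U * V) = (g * V) * U" by (simp only: mult_ac)
  also have "\<dots> = g * 1" by (simp only: V(1)[symmetric] bU mult_1_right)
  finally have "g * (U * V) = g * 1" .
  moreover have "g \<noteq> 0"
  proof
    assume "g = 0"
    hence "b = 0" by (simp add: V(1))
    thus False using b(2) by (simp only: fps_zero_nth norm_zero) simp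
  qed
  ultimately have UV: "U * V = 1" by (metis mult_cancel_left)
  have U1: "(\<Sum>n. (cmod (U $ n))\<^sup>2) \<le> 1"
    using iso[OF U(1) B b_bd] g(2) unfolding bU by simp
  obtain c where c: "cmod c = 1" "V = fps_const c"
    by (rule inverse_pair_constant[OF UV U(1) U1 V(2,3)])
  have "B = dseries (fps_const c * g)"
    by (simp only: B V(1) c(2) mult.commute)
  also have "\<dots> = (\<lambda>z\<in>\<Lambda>\<^sub>+. c * dseries g z)"
    by (rule dseries_scale[OF abs_summable_imp_bounded[OF g_abs]])
  finally have "B = (\<lambda>z\<in>\<Lambda>\<^sub>+. c * dseries g z)" .
  thus ?thesis using c(1) unfolding candidate by blast
qed

end
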